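(* Suppose that $(\mathbb{C}\mathcal{T})^*=\mathbb{C}\mathcal{T}^*$ for any $\mathcal{T}\in\mathcal{H}$. If $\{\mathcal{L}(t)\}_{t\geq0}$ is a family of self-adjoint operators on $H$ and $\mathcal{Y}_0$ is self-adjoint, then the mild solution $\mathcal{Y}$ of $d\mathcal{Y}(t)=\mathbb{C}\mathcal{Y}(t)\,dt+d\mathcal{L}(t)$, $\mathcal{Y}(0)=\mathcal{Y}_0$, is such that $\mathcal{Y}(t)$ is a self-adjoint operator on $H$ for every $t\geq0$.
   Context: $H$ is a real separable Hilbert space and $\mathcal{H}=L_{\mathrm{HS}}(H)$ is the separable Hilbert space of Hilbert-Schmidt operators on $H$. $\mathbb{C}\in L(\mathcal{H})$ is a bounded linear operator on $\mathcal{H}$ and $\mathbb{S}(t)=\exp(t\mathbb{C})$. $\mathcal{L}$ is an $\mathcal{H}$-valued square-integrable Lévy process on a filtered probability space, and $\mathcal{Y}_0\in\mathcal{H}$. The mild solution is $\mathcal{Y}(t)=\mathbb{S}(t)\mathcal{Y}_0+\int_0^t\mathbb{S}(t-s)\,d\mathcal{L}(s)$, $t\ge0$. For $\mathcal{T}\in\mathcal{H}$, $\mathcal{T}^*$ denotes the adjoint of $\mathcal{T}$ as an operator on $H$. Statements about the random operators are understood almost surely. *)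

theory Defs
  imports "HOL-Probability.Probability"
begin

subsection \<open>Separable real Hilbert spaces and orthonormal bases\<close>

class separable_hilbert = real_inner + polish_space

instance separable_hilbert \<subseteq> banach ..

definition orthonormal :: "'a::real_inner set \<Rightarrow> bool" where
  "orthonormal B \<longleftrightarrow> (\<forall>e\<in>B. norm e = 1) \<and> pairwise orthogonal B"

definition orthonormal_basis :: "'a::real_inner set \<Rightarrow> bool" where
  "orthonormal_basis B \<longleftrightarrow> orthonormal B \<and> closure (span B) = UNIV"

lemma has_sum_metric:
  "(f has_sum x) A \<longleftrightarrow> (\<forall>\<epsilon>>0. \<exists>X. finite X \<and> X \<subseteq> A \<and>
     (\<forall>Y. finite Y \<and> X \<subseteq> Y \<and> Y \<subseteq> A \<longrightarrow> dist (sum f Y) x < \<epsilon>))"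
  unfolding has_sum_def tendsto_iff eventually_finite_subsets_at_top by simp

lemma orthonormal_inner:
  "orthonormal B \<Longrightarrow> e \<in> B \<Longrightarrow> e' \<in> B \<Longrightarrow> inner e e' = (if e = e' then 1 else 0)"
  by (auto simp: orthonormal_def pairwise_def orthogonal_def dot_square_norm)

lemma orthonormal_norm_sum:
  fixes B :: "'a::real_inner set"
  assumes B: "orthonormal B" and F: "finite F" "F \<subseteq> B"
  shows "(norm (\<Sum>e\<in>F. c e *\<^sub>R e))\<^sup>2 = (\<Sum>e\<in>F. (c e)\<^sup>2)"
proof -
  have "(norm (\<Sum>e\<in>F. c e *\<^sub>R e))\<^sup>2 = (\<Sum>e\<in>F. \<Sum>e'\<in>F. c e * (c e' * inner e e'))"
    by (simp add: power2_norm_eq_inner inner_sum_left inner_sum_right sum_distrib_left inner_commute mult.left_commute)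
  also have "\<dots> = (\<Sum>e\<in>F. \<Sum>e'\<in>F. if e = e' then (c e)\<^sup>2 else 0)"
    using B F by (intro sum.cong refl) (auto simp: orthonormal_inner subset_iff power2_eq_square)
  finally show ?thesis using F by simp
qed

lemma orthonormal_residual:
  fixes B :: "'a::real_inner set"
  assumes B: "orthonormal B" and F: "finite F" "F \<subseteq> B"
  shows "(norm (x - (\<Sum>e\<in>F. inner x e *\<^sub>R e)))\<^sup>2 = (norm x)\<^sup>2 - (\<Sum>e\<in>F. (inner x e)\<^sup>2)"
proof -
  let ?s = "\<Sum>e\<in>F. inner x e *\<^sub>R e"
  have 1: "inner x ?s = (\<Sum>e\<in>F. (inner x e)\<^sup>2)"
    by (simp add: inner_sum_right power2_eq_square)
  have 2: "inner ?s ?s = (\<Sum>e\<in>F. (inner x e)\<^sup>2)"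
    using orthonormal_norm_sum[OF B F, of "inner x"] by (simp add: power2_norm_eq_inner)
  show ?thesis
    by (simp only: power2_norm_eq_inner inner_diff_left inner_diff_right inner_commute[of ?s x] 1 2)
qed

lemma bessel_finite:
  fixes B :: "'a::real_inner set"
  assumes "orthonormal B" "finite F" "F \<subseteq> B"
  shows "(\<Sum>e\<in>F. (inner x e)\<^sup>2) \<le> (norm x)\<^sup>2"
  using orthonormal_residual[OF assms, of x] zero_le_power2[of "norm (x - (\<Sum>e\<in>F. inner x e *\<^sub>R e))"]
  by linarith

lemma bessel_summable:
  assumes "orthonormal B"
  shows "(\<lambda>e. (inner x e)\<^sup>2) summable_on B"
  by (rule nonneg_bdd_above_summable_on)
     (auto simp: bdd_above_def intro!: exI[of _ "(norm x)\<^sup>2"] bessel_finite[OF assms])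

lemma orthonormal_best_approx:
  fixes B :: "'a::real_inner set"
  assumes B: "orthonormal B" and F: "finite F" "F \<subseteq> B"
  shows "norm (x - (\<Sum>e\<in>F. inner x e *\<^sub>R e)) \<le> norm (x - (\<Sum>e\<in>F. c e *\<^sub>R e))"
proof -
  let ?s = "\<Sum>e\<in>F. inner x e *\<^sub>R e" and ?t = "\<Sum>e\<in>F. c e *\<^sub>R e"
  let ?d = "\<Sum>e\<in>F. (inner x e - c e) *\<^sub>R e"
  have eq: "x - ?t = (x - ?s) + ?d"
    by (simp add: scaleR_diff_left sum_subtractf)
  have in0: "inner (x - ?s) e = 0" if "e \<in> F" for e
  proof -
    have "inner ?s e = (\<Sum>e'\<in>F. if e' = e then inner x e else 0)"
      unfolding inner_sum_left using that F
      by (intro sum.cong refl) (auto simp: orthonormal_inner[OF B] subset_iff)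
    thus ?thesis using that F by (simp add: inner_diff_left)
  qed
  have "inner (x - ?s) ?d = 0"
    unfolding inner_sum_right by (intro sum.neutral ballI) (simp only: inner_scaleR_right in0 mult_zero_right)
  hence "(norm (x - ?t))\<^sup>2 = (norm (x - ?s))\<^sup>2 + (norm ?d)\<^sup>2"
    unfolding eq by (simp add: power2_norm_eq_inner inner_add_left inner_add_right inner_commute)
  hence "(norm (x - ?s))\<^sup>2 \<le> (norm (x - ?t))\<^sup>2" by simp
  thus ?thesis using norm_ge_zero power2_le_imp_le by blast
qed

lemma onb_has_sum:
  fixes B :: "'a::real_inner set"
  assumes B: "orthonormal_basis B"
  shows "((\<lambda>e. inner x e *\<^sub>R e) has_sum x) B"
  unfolding has_sum_metric
proof (intro allI impI)
  fix \<epsilon> :: real assume "\<epsilon> > 0"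
  have on: "orthonormal B" using B by (simp add: orthonormal_basis_def)
  have "x \<in> closure (span B)" using B by (simp add: orthonormal_basis_def)
  then obtain y where y: "y \<in> span B" "dist y x < \<epsilon>"
    using \<open>\<epsilon> > 0\<close> closure_approachable by blast
  obtain S r where S: "finite S" "S \<subseteq> B" "y = (\<Sum>a\<in>S. r a *\<^sub>R a)"
    using y(1) unfolding span_explicit by blast
  show "\<exists>X. finite X \<and> X \<subseteq> B \<and>
        (\<forall>Y. finite Y \<and> X \<subseteq> Y \<and> Y \<subseteq> B \<longrightarrow> dist (\<Sum>e\<in>Y. inner x e *\<^sub>R e) x < \<epsilon>)"
  proof (intro exI[of _ S] conjI S allI impI)
    fix Y assume Y: "finite Y \<and> S \<subseteq> Y \<and> Y \<subseteq> B"
    have "y = (\<Sum>a\<in>Y. (if a \<in> S then r a else 0) *\<^sub>R a)"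
      unfolding S(3) by (rule sum.mono_neutral_cong_left) (use Y in auto)
    hence "norm (x - (\<Sum>e\<in>Y. inner x e *\<^sub>R e)) \<le> norm (x - y)"
      using orthonormal_best_approx[OF on, of Y x] Y by metis
    thus "dist (\<Sum>e\<in>Y. inner x e *\<^sub>R e) x < \<epsilon>"
      using y(2) by (simp add: dist_norm norm_minus_commute)
  qed
qed

lemma parseval:
  fixes B :: "'a::real_inner set"
  assumes "orthonormal_basis B"
  shows "((\<lambda>e. (inner x e)\<^sup>2) has_sum (norm x)\<^sup>2) B"
  using has_sum_bounded_linear[OF bounded_linear_inner_right onb_has_sum[OF assms, of x], of x]
  by (simp add: o_def power2_eq_square dot_square_norm)

lemma orthonormal_summable:
  fixes B :: "'a::{real_inner, complete_space} set"
  assumes B: "orthonormal B" and c: "(\<lambda>e. (c e)\<^sup>2) summable_on B"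
  shows "(\<lambda>e. c e *\<^sub>R e) summable_on B"
proof -
  let ?s = "\<lambda>F. \<Sum>e\<in>F. c e *\<^sub>R e"
  obtain l where l: "((\<lambda>e. (c e)\<^sup>2) has_sum l) B" using c by (auto simp: summable_on_def)
  have "cauchy_filter (filtermap ?s (finite_subsets_at_top B))"
    unfolding cauchy_filter_metric_filtermap
  proof (intro allI impI)
    fix e :: real assume e: "e > 0"
    obtain X where X: "finite X" "X \<subseteq> B"
      "\<And>Y. finite Y \<Longrightarrow> X \<subseteq> Y \<Longrightarrow> Y \<subseteq> B \<Longrightarrow> dist (\<Sum>e\<in>Y. (c e)\<^sup>2) l < (e/2)\<^sup>2 / 2"
      using l[unfolded has_sum_metric, rule_format, of "(e/2)\<^sup>2/2"] e by auto
    have half: "dist (?s Y) (?s X) < e/2" if "finite Y" "X \<subseteq> Y" "Y \<subseteq> B" for Y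
    proof -
      have "?s Y - ?s X = ?s (Y - X)" using that sum_diff[of Y X] by metis
      hence "(norm (?s Y - ?s X))\<^sup>2 = (\<Sum>e\<in>Y-X. (c e)\<^sup>2)"
        using orthonormal_norm_sum[OF B, of "Y - X" c] that by (simp add: subset_iff)
      also have "\<dots> = (\<Sum>e\<in>Y. (c e)\<^sup>2) - (\<Sum>e\<in>X. (c e)\<^sup>2)" using that by (simp add: sum_diff)
      also have "\<dots> < (e/2)\<^sup>2"
        using X(3)[OF that] X(3)[OF X(1) order_refl X(2)] unfolding dist_real_def by linarith
      finally show ?thesis using e unfolding dist_norm by (intro power2_less_imp_less[of _ "e/2"]) auto
    qed
    have ev: "\<forall>\<^sub>F Y in finite_subsets_at_top B. finite Y \<and> X \<subseteq> Y \<and> Y \<subseteq> B"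
      using X unfolding eventually_finite_subsets_at_top by (intro exI[of _ X]) auto
    show "\<exists>P. eventually P (finite_subsets_at_top B) \<and> (\<forall>x y. P x \<and> P y \<longrightarrow> dist (?s x) (?s y) < e)"
    proof (intro exI conjI, rule ev, intro allI impI)
      fix Y Z assume "(finite Y \<and> X \<subseteq> Y \<and> Y \<subseteq> B) \<and> finite Z \<and> X \<subseteq> Z \<and> Z \<subseteq> B"
      hence "dist (?s Y) (?s X) < e/2" "dist (?s Z) (?s X) < e/2" using half by auto
      thus "dist (?s Y) (?s Z) < e"
        using dist_triangle2[of "?s Y" "?s Z" "?s X"] by linarith
    qed
  qed
  then obtain x where "filtermap ?s (finite_subsets_at_top B) \<le> nhds x"
    by (meson cauchy_filter_convergent convergent_filter_iff)
  hence "((\<lambda>e. c e *\<^sub>R e) has_sum x) B" by (simp add: has_sum_def filterlim_def)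
  thus ?thesis by (auto simp: summable_on_def)
qed

lemma orthonormal_infsum_inner:
  fixes B :: "'a::{real_inner, complete_space} set"
  assumes B: "orthonormal B" and c: "(\<lambda>e. (c e)\<^sup>2) summable_on B" and e: "e \<in> B"
  shows "inner (\<Sum>\<^sub>\<infinity>e\<in>B. c e *\<^sub>R e) e = c e"
proof -
  have "((\<lambda>e. c e *\<^sub>R e) has_sum (\<Sum>\<^sub>\<infinity>e\<in>B. c e *\<^sub>R e)) B"
    using orthonormal_summable[OF B c] by simp
  from has_sum_bounded_linear[OF bounded_linear_inner_left this, of e]
  have "((\<lambda>e'. c e' * inner e' e) has_sum inner (\<Sum>\<^sub>\<infinity>e\<in>B. c e *\<^sub>R e) e) B" by (simp add: o_def)
  moreover have "((\<lambda>e'. c e' * inner e' e) has_sum c e) B"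
    by (rule has_sum_finite_neutralI[of "{e}"]) (use e in \<open>auto simp: orthonormal_inner[OF B]\<close>)
  ultimately show ?thesis using has_sum_unique by blast
qed

lemma ex_orthonormal_basis: "\<exists>B::'a::{real_inner, complete_space} set. orthonormal_basis B"
proof -
  have "\<exists>M\<in>{B::'a set. orthonormal B}. \<forall>X\<in>{B. orthonormal B}. M \<subseteq> X \<longrightarrow> X = M"
  proof (rule subset_Zorn')
    fix C :: "'a set set" assume C: "subset.chain {B. orthonormal B} C"
    have "pairwise orthogonal (\<Union>C)"
    proof (rule pairwise_chain_Union)
      show "chain\<^sub>\<subseteq> C" using C by (simp add: subset_chain_def chain_subset_def)
      show "pairwise orthogonal S" if "S \<in> C" for S
        using C that by (auto simp: subset_chain_def orthonormal_def)
    qed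
    thus "\<Union>C \<in> {B. orthonormal B}"
      using C by (auto simp: orthonormal_def subset_chain_def)
  qed
  then obtain B :: "'a set" where B: "orthonormal B" and
    mx: "\<And>X. orthonormal X \<Longrightarrow> B \<subseteq> X \<Longrightarrow> X = B" by auto
  have "x \<in> closure (span B)" for x
  proof -
    let ?c = "inner x" let ?s = "\<Sum>\<^sub>\<infinity>e\<in>B. ?c e *\<^sub>R e"
    have sm: "(\<lambda>e. ?c e *\<^sub>R e) summable_on B"
      by (rule orthonormal_summable[OF B bessel_summable[OF B]])
    have s_in: "?s \<in> closure (span B)"
    proof (rule Lim_in_closed_set[OF closed_closure _ finite_subsets_at_top_neq_bot infsum_tendsto[OF sm]])
      show "\<forall>\<^sub>F F in finite_subsets_at_top B. (\<Sum>e\<in>F. ?c e *\<^sub>R e) \<in> closure (span B)"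
        unfolding eventually_finite_subsets_at_top
        by (intro exI[of _ "{}"] conjI allI impI subsetD[OF closure_subset] span_sum span_scale)
           (auto intro: span_base)
    qed
    have "x - ?s = 0"
    proof (rule ccontr)
      assume nz: "x - ?s \<noteq> 0"
      let ?z = "(x - ?s) /\<^sub>R norm (x - ?s)"
      have orth: "inner ?z e = 0" if "e \<in> B" for e
        using orthonormal_infsum_inner[OF B bessel_summable[OF B] that, of x] that
        by (simp add: inner_diff_left)
      have nz1: "norm ?z = 1" using nz by simp
      have "orthonormal (insert ?z B)"
        unfolding orthonormal_def pairwise_insert
      proof (intro conjI ballI allI impI)
        fix e assume "e \<in> insert ?z B" thus "norm e = 1" using B nz1 by (auto simp only: orthonormal_def insert_iff)
      next
        show "pairwise orthogonal B" using B by (simp add: orthonormal_def)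
      next
        fix y assume "y \<in> B \<and> y \<noteq> ?z"
        thus "orthogonal ?z y" "orthogonal y ?z"
          using orth[of y] unfolding orthogonal_def by (simp_all only: inner_commute[of y])
      qed
      hence "?z \<in> B" using mx by blast
      from orth[OF this] nz1 show False by (simp only: dot_square_norm) simp
    qed
    thus ?thesis using s_in by simp
  qed
  thus ?thesis using B by (auto simp: orthonormal_basis_def)
qed

lemma orthonormal_countable:
  fixes B :: "'a::separable_hilbert set"
  assumes "orthonormal B" shows "countable B"
proof -
  have d: "dist e e' > 1" if "e \<in> B" "e' \<in> B" "e \<noteq> e'" for e e'
  proof -
    have "(dist e e')\<^sup>2 = 2"
      using that orthonormal_inner[OF assms]
      by (simp add: dist_norm power2_norm_eq_inner inner_diff_left inner_diff_right)
    hence "1\<^sup>2 < (dist e e')\<^sup>2" by simp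
    thus ?thesis using power2_less_imp_less zero_le_dist by blast
  qed
  have disj: "disjoint ((\<lambda>e. ball e (1/2)) ` B)"
  proof (clarsimp simp: pairwise_def disjnt_def)
    fix e e' assume "e \<in> B" "e' \<in> B" "ball e (1/2) \<noteq> ball e' (1/2)"
    hence "dist e e' > 1" using d by blast
    thus "ball e (1/2) \<inter> ball e' (1/2) = {}"
      by (intro disjoint_ballI) simp
  qed
  have "countable ((\<lambda>e. ball e (1/2)) ` B)"
    by (rule countable_disjoint_open_subsets[OF _ disj]) auto
  moreover have "inj_on (\<lambda>e. ball e (1/2::real)) B"
  proof (rule inj_onI, rule ccontr)
    fix e e' assume h: "e \<in> B" "e' \<in> B" "ball e (1/2::real) = ball e' (1/2)" "e \<noteq> e'"
    hence "e \<in> ball e' (1/2)" using centre_in_ball[of e "1/2"] by simp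
    thus False using d[OF h(1,2,4)] by (simp add: dist_commute)
  qed
  ultimately show ?thesis using countable_image_inj_on by blast
qed

lemma bounded_linear_adjoint_ex:
  fixes f :: "'a::{real_inner, complete_space} \<Rightarrow> 'b::real_inner"
  assumes f: "bounded_linear f"
  shows "\<exists>g. \<forall>x y. inner (f x) y = inner x (g y)"
proof -
  obtain B :: "'a set" where B: "orthonormal_basis B" using ex_orthonormal_basis by blast
  hence on: "orthonormal B" by (simp add: orthonormal_basis_def)
  interpret f: bounded_linear f by (rule f)
  obtain K where K: "K \<ge> 0" "\<And>x. norm (f x) \<le> norm x * K" using f.nonneg_bounded by auto
  have sm: "(\<lambda>e. (inner (f e) y)\<^sup>2) summable_on B" for y
  proof (rule nonneg_bdd_above_summable_on)
    show "bdd_above (sum (\<lambda>e. (inner (f e) y)\<^sup>2) ` {F. F \<subseteq> B \<and> finite F})"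
    proof (rule bdd_aboveI2)
      fix F assume "F \<in> {F. F \<subseteq> B \<and> finite F}"
      hence F: "F \<subseteq> B" "finite F" by auto
      let ?q = "\<Sum>e\<in>F. (inner (f e) y)\<^sup>2" and ?x = "\<Sum>e\<in>F. inner (f e) y *\<^sub>R e"
      have n: "(norm ?x)\<^sup>2 = ?q" by (rule orthonormal_norm_sum[OF on F(2,1)])
      have "?q = inner (f ?x) y"
        by (simp add: f.sum f.scaleR inner_sum_left power2_eq_square)
      also have "\<dots> \<le> norm ?x * (K * norm y)"
        using norm_cauchy_schwarz[of "f ?x" y] mult_right_mono[OF K(2)[of ?x], of "norm y"] by (simp add: mult.assoc)
      finally have le: "(norm ?x)\<^sup>2 \<le> norm ?x * (K * norm y)" using n by simp
      have "norm ?x \<le> K * norm y"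
        by (cases "norm ?x = 0") (use le K(1) in \<open>simp, simp add: power2_eq_square\<close>)
      hence "(norm ?x)\<^sup>2 \<le> (K * norm y)\<^sup>2" using norm_ge_zero power_mono by blast
      thus "?q \<le> (K * norm y)\<^sup>2" using n by simp
    qed
  qed simp
  let ?g = "\<lambda>y. \<Sum>\<^sub>\<infinity>e\<in>B. inner (f e) y *\<^sub>R e"
  have "inner (f x) y = inner x (?g y)" for x y
  proof -
    have "bounded_linear (\<lambda>x. inner (f x) y)"
      using bounded_linear_compose[OF bounded_linear_inner_left f] by simp
    from has_sum_bounded_linear[OF this onb_has_sum[OF B, of x]]
    have "((\<lambda>e. inner x e * inner (f e) y) has_sum inner (f x) y) B" by (simp add: o_def f.scaleR)
    moreover have "((\<lambda>e. inner (f e) y *\<^sub>R e) has_sum ?g y) B"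
      using orthonormal_summable[OF on sm] by simp
    from has_sum_bounded_linear[OF bounded_linear_inner_right this, of x]
    have "((\<lambda>e. inner x e * inner (f e) y) has_sum inner x (?g y)) B" by (simp add: o_def mult.commute)
    ultimately show ?thesis using has_sum_unique by blast
  qed
  thus ?thesis by (intro exI[of _ ?g] allI)
qed

lemma inner_adjoint:
  fixes f :: "'a::{real_inner, complete_space} \<Rightarrow> 'b::real_inner"
  assumes "bounded_linear f"
  shows "inner (f x) y = inner x (adjoint f y)"
  using someI_ex[OF bounded_linear_adjoint_ex[OF assms]] unfolding adjoint_def by blast

lemma bounded_linear_adjoint:
  fixes f :: "'a::{real_inner, complete_space} \<Rightarrow> 'b::real_inner"
  assumes f: "bounded_linear f"
  shows "bounded_linear (adjoint f)"
proof -
  interpret f: bounded_linear f by (rule f)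
  obtain K where K: "K \<ge> 0" "\<And>x. norm (f x) \<le> norm x * K" using f.nonneg_bounded by auto
  note a = inner_adjoint[OF f, symmetric]
  show ?thesis
  proof (rule bounded_linear_intro[of _ K])
    fix x y show "adjoint f (x + y) = adjoint f x + adjoint f y"
      by (rule vector_eq_ldot[THEN iffD1]) (simp add: a inner_add_right)
  next
    fix r x show "adjoint f (r *\<^sub>R x) = r *\<^sub>R adjoint f x"
      by (rule vector_eq_ldot[THEN iffD1]) (simp add: a)
  next
    fix y let ?x = "adjoint f y"
    have "(norm ?x)\<^sup>2 = inner (f ?x) y" by (simp add: power2_norm_eq_inner a)
    also have "\<dots> \<le> norm ?x * (K * norm y)"
      using norm_cauchy_schwarz[of "f ?x" y] mult_right_mono[OF K(2)[of ?x], of "norm y"] by (simp add: mult.assoc)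
    finally have le: "(norm ?x)\<^sup>2 \<le> norm ?x * (K * norm y)" .
    have "norm ?x \<le> K * norm y"
      by (cases "norm ?x = 0") (use le K(1) in \<open>simp, simp add: power2_eq_square\<close>)
    thus "norm ?x \<le> norm y * K" by (simp add: mult.commute)
  qed
qed

subsection \<open>Hilbert--Schmidt operators\<close>

lemma adjoint_adjoint:
  fixes f :: "'a::{real_inner, complete_space} \<Rightarrow> 'b::real_inner"
  assumes "bounded_linear f"
  shows "adjoint (adjoint f) = f"
  by (rule adjoint_unique) (metis inner_adjoint[OF assms] inner_commute)

lemma has_sum_norm_adjoint:
  fixes f :: "'a::{real_inner, complete_space} \<Rightarrow> 'b::real_inner"
  assumes f: "bounded_linear f" and B: "orthonormal_basis B" and B': "orthonormal_basis B'"
    and s: "((\<lambda>e. (norm (f e))\<^sup>2) has_sum s) B"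
  shows "((\<lambda>e. (norm (adjoint f e))\<^sup>2) has_sum s) B'"
proof -
  let ?g = "\<lambda>(e, e'). (inner (f e) e')\<^sup>2"
  have r: "((\<lambda>e'. ?g (e, e')) has_sum (norm (f e))\<^sup>2) B'" for e
    using parseval[OF B', of "f e"] by simp
  have "?g summable_on B \<times> B'"
    using s by (intro summable_on_SigmaI[OF r]) (auto simp: summable_on_def)
  from has_sum_SigmaI[OF r s this] have "(?g has_sum s) (B \<times> B')" .
  hence "((\<lambda>(e', e). (inner (f e) e')\<^sup>2) has_sum s) (B' \<times> B)"
    by (subst (asm) has_sum_swap) (simp add: case_prod_unfold)
  thus ?thesis
  proof (rule has_sum_SigmaD)
    fix e' show "((\<lambda>e. case (e', e) of (e', e) \<Rightarrow> (inner (f e) e')\<^sup>2) has_sum (norm (adjoint f e'))\<^sup>2) B"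
      using parseval[OF B, of "adjoint f e'"]
      by (simp add: inner_adjoint[OF f] inner_commute[of "adjoint f e'"])
  qed
qed

text \<open>By \<open>hilbert_schmidt_has_sum\<close> below, the sum \<open>\<Sum>\<parallel>T e\<parallel>\<^sup>2\<close> has the same value (or diverges) for all
  orthonormal bases.\<close>

definition hilbert_schmidt :: "('a::separable_hilbert \<Rightarrow>\<^sub>L 'a) \<Rightarrow> bool" where
  "hilbert_schmidt T \<longleftrightarrow>
     (\<exists>B. orthonormal_basis B \<and> (\<lambda>e. (norm (blinfun_apply T e))\<^sup>2) summable_on B)"

lemma hilbert_schmidt_has_sum:
  fixes T :: "'a::separable_hilbert \<Rightarrow>\<^sub>L 'a"
  assumes B: "orthonormal_basis B" and B': "orthonormal_basis B'"
    and s: "((\<lambda>e. (norm (blinfun_apply T e))\<^sup>2) has_sum s) B"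
  shows "((\<lambda>e. (norm (blinfun_apply T e))\<^sup>2) has_sum s) B'"
proof -
  have bl: "bounded_linear (blinfun_apply T)" by (rule blinfun.bounded_linear_right)
  have "((\<lambda>e. (norm (adjoint (adjoint (blinfun_apply T)) e))\<^sup>2) has_sum s) B'"
    by (rule has_sum_norm_adjoint[OF bounded_linear_adjoint[OF bl] B B' has_sum_norm_adjoint[OF bl B B s]])
  thus ?thesis by (simp add: adjoint_adjoint[OF bl])
qed

lemma hilbert_schmidt_summable:
  "hilbert_schmidt T \<Longrightarrow> orthonormal_basis B \<Longrightarrow> (\<lambda>e. (norm (blinfun_apply T e))\<^sup>2) summable_on B"
  unfolding hilbert_schmidt_def summable_on_def by (metis hilbert_schmidt_has_sum)

lemma hilbert_schmidtI:
  "orthonormal_basis B \<Longrightarrow> (\<lambda>e. (norm (blinfun_apply T e))\<^sup>2) summable_on B \<Longrightarrow> hilbert_schmidt T"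
  unfolding hilbert_schmidt_def by blast

lemma hilbert_schmidt_0: "hilbert_schmidt 0"
  using ex_orthonormal_basis by (auto simp: hilbert_schmidt_def)

lemma hilbert_schmidt_scaleR:
  assumes "hilbert_schmidt T" shows "hilbert_schmidt (r *\<^sub>R T)"
proof -
  obtain B :: "'a set" where B: "orthonormal_basis B" using ex_orthonormal_basis by blast
  show ?thesis
    using summable_on_cmult_right[OF hilbert_schmidt_summable[OF assms B], of "r\<^sup>2"]
    by (intro hilbert_schmidtI[OF B]) (simp add: blinfun.scaleR_left power_mult_distrib)
qed

lemma hilbert_schmidt_uminus:
  assumes "hilbert_schmidt T" shows "hilbert_schmidt (- T)"
  using hilbert_schmidt_scaleR[OF assms, of "- 1"] by simp

lemma hilbert_schmidt_add:
  assumes "hilbert_schmidt S" "hilbert_schmidt T" shows "hilbert_schmidt (S + T)"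
proof -
  obtain B :: "'a set" where B: "orthonormal_basis B" using ex_orthonormal_basis by blast
  have "(\<lambda>e. 2 * ((norm (blinfun_apply S e))\<^sup>2 + (norm (blinfun_apply T e))\<^sup>2)) summable_on B"
    by (intro summable_on_cmult_right summable_on_add hilbert_schmidt_summable assms B)
  hence "(\<lambda>e. (norm (blinfun_apply (S + T) e))\<^sup>2) summable_on B"
  proof (rule summable_on_comparison_test)
    fix e
    have "(norm (S e + T e))\<^sup>2 \<le> (norm (S e) + norm (T e))\<^sup>2"
      by (intro power_mono norm_triangle_ineq) simp
    also have "\<dots> \<le> 2 * ((norm (S e))\<^sup>2 + (norm (T e))\<^sup>2)"
      using sum_squares_bound[of "norm (S e)" "norm (T e)"] by (simp add: power2_sum)
    finally show "(norm (blinfun_apply (S + T) e))\<^sup>2 \<le> 2 * ((norm (S e))\<^sup>2 + (norm (T e))\<^sup>2)"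
      by (simp add: blinfun.add_left)
  qed simp
  thus ?thesis by (rule hilbert_schmidtI[OF B])
qed

lemma hilbert_schmidt_diff:
  "hilbert_schmidt S \<Longrightarrow> hilbert_schmidt T \<Longrightarrow> hilbert_schmidt (S - T)"
  using hilbert_schmidt_add[OF _ hilbert_schmidt_uminus] by fastforce

typedef (overloaded) 'a hs = "{T :: 'a::separable_hilbert \<Rightarrow>\<^sub>L 'a. hilbert_schmidt T}"
  morphisms op_of Abs_hs
  using hilbert_schmidt_0 by blast

setup_lifting type_definition_hs

text \<open>An arbitrary basis in which the Hilbert--Schmidt inner product \<open>\<Sum>\<langle>S e, T e\<rangle>\<close> is computed;
  \<open>norm_hs_has_sum\<close> shows that the resulting norm does not depend on it.\<close>

definition hs_basis :: "'a::{real_inner, complete_space} set" where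
  "hs_basis = (SOME B. orthonormal_basis B)"

lemma hs_basis: "orthonormal_basis hs_basis"
  unfolding hs_basis_def by (rule someI_ex[OF ex_orthonormal_basis])

lemma op_of_summable:
  "orthonormal_basis B \<Longrightarrow> (\<lambda>e. (norm (blinfun_apply (op_of T) e))\<^sup>2) summable_on B"
  using op_of[of T] by (simp add: hilbert_schmidt_summable)

lemma op_of_inner_summable:
  assumes B: "orthonormal_basis B"
  shows "(\<lambda>e. inner (blinfun_apply (op_of S) e) (blinfun_apply (op_of T) e)) summable_on B"
proof -
  have "(\<lambda>e. (norm (op_of S e))\<^sup>2 + (norm (op_of T e))\<^sup>2) summable_on B"
    by (intro summable_on_add op_of_summable B)
  hence "(\<lambda>e. norm (inner (op_of S e) (op_of T e))) summable_on B"
  proof (rule summable_on_comparison_test)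
    show "norm (inner (op_of S e) (op_of T e)) \<le> (norm (op_of S e))\<^sup>2 + (norm (op_of T e))\<^sup>2" for e
      using Cauchy_Schwarz_ineq2[of "op_of S e" "op_of T e"] sum_squares_bound[of "norm (op_of S e)" "norm (op_of T e)"]
        mult_nonneg_nonneg[OF norm_ge_zero norm_ge_zero, of "op_of S e" "op_of T e"] unfolding real_norm_def
      by linarith
  qed simp
  thus ?thesis by (rule abs_summable_summable)
qed

lemma op_of_eq_0_basis:
  fixes T :: "'a::separable_hilbert hs"
  assumes B: "orthonormal_basis B" and z: "\<And>e. e \<in> B \<Longrightarrow> blinfun_apply (op_of T) e = 0"
  shows "op_of T = 0"
proof -
  have "op_of T x = 0" for x
  proof -
    from has_sum_bounded_linear[OF blinfun.bounded_linear_right onb_has_sum[OF B, of x], of "op_of T"]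
    have "((\<lambda>e. inner x e *\<^sub>R op_of T e) has_sum op_of T x) B"
      by (simp add: o_def blinfun.scaleR_right)
    moreover have "((\<lambda>e. inner x e *\<^sub>R op_of T e) has_sum 0) B"
      by (rule has_sum_0) (simp add: z)
    ultimately show ?thesis using has_sum_unique by blast
  qed
  thus ?thesis by (intro blinfun_eqI) simp
qed

instantiation hs :: (separable_hilbert) real_inner
begin

lift_definition zero_hs :: "'a hs" is 0 by (rule hilbert_schmidt_0)
lift_definition plus_hs :: "'a hs \<Rightarrow> 'a hs \<Rightarrow> 'a hs" is "(+)" by (rule hilbert_schmidt_add)
lift_definition minus_hs :: "'a hs \<Rightarrow> 'a hs \<Rightarrow> 'a hs" is "(-)" by (rule hilbert_schmidt_diff)
lift_definition uminus_hs :: "'a hs \<Rightarrow> 'a hs" is uminus by (rule hilbert_schmidt_uminus)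
lift_definition scaleR_hs :: "real \<Rightarrow> 'a hs \<Rightarrow> 'a hs" is scaleR by (rule hilbert_schmidt_scaleR)

definition inner_hs :: "'a hs \<Rightarrow> 'a hs \<Rightarrow> real" where
  "inner_hs S T = (\<Sum>\<^sub>\<infinity>e\<in>hs_basis. inner (blinfun_apply (op_of S) e) (blinfun_apply (op_of T) e))"

definition norm_hs :: "'a hs \<Rightarrow> real" where "norm_hs T = sqrt (inner T T)"
definition dist_hs :: "'a hs \<Rightarrow> 'a hs \<Rightarrow> real" where "dist_hs S T = norm (S - T)"
definition sgn_hs :: "'a hs \<Rightarrow> 'a hs" where "sgn_hs T = scaleR (inverse (norm T)) T"
definition uniformity_hs :: "('a hs \<times> 'a hs) filter" where
  "uniformity_hs = (INF e\<in>{0<..}. principal {(x, y). dist x y < e})"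
definition open_hs :: "'a hs set \<Rightarrow> bool" where
  "open_hs U = (\<forall>x\<in>U. \<forall>\<^sub>F (x', y) in uniformity. x' = x \<longrightarrow> y \<in> U)"

instance
proof
  fix x y z :: "'a hs" and r s :: real
  show "x + y + z = x + (y + z)" by transfer simp
  show "x + y = y + x" by transfer simp
  show "0 + x = x" by transfer simp
  show "- x + x = 0" by transfer simp
  show "x - y = x + - y" by transfer simp
  show "r *\<^sub>R (x + y) = r *\<^sub>R x + r *\<^sub>R y" by transfer (simp add: scaleR_add_right)
  show "(r + s) *\<^sub>R x = r *\<^sub>R x + s *\<^sub>R x" by transfer (simp add: scaleR_add_left)
  show "r *\<^sub>R s *\<^sub>R x = (r * s) *\<^sub>R x" by transfer simp
  show "1 *\<^sub>R x = x" by transfer simp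
  show "dist x y = norm (x - y)" by (rule dist_hs_def)
  show "sgn x = scaleR (inverse (norm x)) x" by (rule sgn_hs_def)
  show "(uniformity :: ('a hs \<times> 'a hs) filter) = (INF e\<in>{0<..}. principal {(x, y). dist x y < e})"
    by (rule uniformity_hs_def)
  show "open U = (\<forall>x\<in>U. \<forall>\<^sub>F (x', y) in uniformity. x' = x \<longrightarrow> y \<in> U)" for U :: "'a hs set"
    by (rule open_hs_def)
  show "inner x y = inner y x" unfolding inner_hs_def by (simp add: inner_commute)
  show "inner (x + y) z = inner x z + inner y z"
    unfolding inner_hs_def
    by (simp add: plus_hs.rep_eq blinfun.add_left inner_add_left infsum_add[OF op_of_inner_summable[OF hs_basis] op_of_inner_summable[OF hs_basis]])
  show "inner (r *\<^sub>R x) y = r * inner x y"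
    unfolding inner_hs_def
    by (simp add: scaleR_hs.rep_eq blinfun.scaleR_left infsum_cmult_right')
  show ge0: "0 \<le> inner x x" unfolding inner_hs_def by (intro infsum_nonneg) simp
  show "norm x = sqrt (inner x x)" by (rule norm_hs_def)
  show "inner x x = 0 \<longleftrightarrow> x = 0"
  proof
    assume "x = 0" thus "inner x x = 0" by (simp add: inner_hs_def zero_hs.rep_eq)
  next
    assume h: "inner x x = 0"
    have "inner (op_of x e) (op_of x e) = 0" if "e \<in> hs_basis" for e
      by (rule nonneg_infsum_le_0D[OF _ op_of_inner_summable[OF hs_basis, of x x] _ that])
         (use h in \<open>simp_all add: inner_hs_def\<close>)
    hence "op_of x = 0" by (intro op_of_eq_0_basis[OF hs_basis]) simp
    thus "x = 0" by (simp add: op_of_inject[symmetric] zero_hs.rep_eq)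
  qed
qed

end

lemma norm_hs_has_sum:
  assumes B: "orthonormal_basis B"
  shows "((\<lambda>e. (norm (blinfun_apply (op_of T) e))\<^sup>2) has_sum (norm T)\<^sup>2) B"
proof (rule hilbert_schmidt_has_sum[OF hs_basis B])
  show "((\<lambda>e. (norm (blinfun_apply (op_of T) e))\<^sup>2) has_sum (norm T)\<^sup>2) hs_basis"
    using has_sum_infsum[OF op_of_summable[OF hs_basis, of T]]
    by (simp add: power2_norm_eq_inner inner_hs_def)
qed

lemma norm_op_of_le: "norm (op_of T) \<le> norm T"
proof (rule norm_blinfun_bound)
  fix x :: 'a
  from has_sum_bounded_linear[OF blinfun.bounded_linear_right onb_has_sum[OF hs_basis, of x], of "op_of T"]
  have "((\<lambda>e. inner x e *\<^sub>R op_of T e) has_sum op_of T x) hs_basis"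
    by (simp add: o_def blinfun.scaleR_right)
  hence lim: "((\<lambda>F. norm (\<Sum>e\<in>F. inner x e *\<^sub>R op_of T e)) \<longlongrightarrow> norm (op_of T x)) (finite_subsets_at_top hs_basis)"
    unfolding has_sum_def by (rule tendsto_norm)
  have on: "orthonormal (hs_basis :: 'a set)" using hs_basis by (auto simp: orthonormal_basis_def)
  have le: "norm (\<Sum>e\<in>F. inner x e *\<^sub>R op_of T e) \<le> norm T * norm x" if F: "finite F" "F \<subseteq> hs_basis" for F
  proof -
    have "norm (\<Sum>e\<in>F. inner x e *\<^sub>R op_of T e) \<le> (\<Sum>e\<in>F. \<bar>norm (op_of T e)\<bar> * \<bar>inner x e\<bar>)"
      by (intro sum_norm_le) (simp add: mult.commute)
    also have "\<dots> \<le> L2_set (\<lambda>e. norm (op_of T e)) F * L2_set (inner x) F" by (rule L2_set_mult_ineq)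
    also have "\<dots> \<le> norm T * norm x"
    proof (rule mult_mono)
      show "L2_set (inner x) F \<le> norm x"
        unfolding L2_set_def using bessel_finite[OF on F, of x] by (intro real_le_lsqrt) (auto intro: sum_nonneg)
      have "(\<Sum>e\<in>F. (norm (op_of T e))\<^sup>2) \<le> (norm T)\<^sup>2"
        by (rule finite_sum_le_has_sum[OF norm_hs_has_sum[OF hs_basis] F]) simp
      thus "L2_set (\<lambda>e. norm (op_of T e)) F \<le> norm T"
        unfolding L2_set_def by (intro real_le_lsqrt) (auto intro: sum_nonneg)
    qed (auto simp: L2_set_nonneg)
    finally show ?thesis .
  qed
  show "norm (op_of T x) \<le> norm T * norm x"
    by (rule tendsto_upperbound[OF lim])
       (auto simp: eventually_finite_subsets_at_top intro!: exI[of _ "{}"] le)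
qed simp

instance hs :: (separable_hilbert) complete_space
proof
  fix X :: "nat \<Rightarrow> 'a hs"
  assume C: "Cauchy X"
  have "Cauchy (\<lambda>n. op_of (X n))"
    unfolding Cauchy_def
  proof (intro allI impI)
    fix e :: real assume "e > 0"
    then obtain N where N: "\<And>m n. m \<ge> N \<Longrightarrow> n \<ge> N \<Longrightarrow> dist (X m) (X n) < e"
      using metric_CauchyD[OF C] by blast
    have "dist (op_of (X m)) (op_of (X n)) \<le> dist (X m) (X n)" for m n
      using norm_op_of_le[of "X m - X n"] by (simp add: dist_norm minus_hs.rep_eq)
    thus "\<exists>M. \<forall>m\<ge>M. \<forall>n\<ge>M. dist (op_of (X m)) (op_of (X n)) < e"
      by (intro exI[of _ N] allI impI) (rule le_less_trans[OF _ N])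
  qed
  then obtain A where A: "(\<lambda>n. op_of (X n)) \<longlonglongrightarrow> A"
    using Cauchy_convergent unfolding convergent_def by metis
  have key: "hilbert_schmidt (op_of (X n) - A) \<and>
      (\<forall>D. op_of D = op_of (X n) - A \<longrightarrow> norm D \<le> e)"
    if e: "e > 0" and N: "\<And>m. m \<ge> N \<Longrightarrow> dist (X n) (X m) < e" for e n N
  proof -
    let ?h = "\<lambda>e. (norm ((op_of (X n) - A) e))\<^sup>2"
    have fin: "sum ?h F \<le> e\<^sup>2" if F: "finite F" "F \<subseteq> hs_basis" for F
    proof (rule tendsto_upperbound)
      show "(\<lambda>m. \<Sum>b\<in>F. (norm ((op_of (X n) - op_of (X m)) b))\<^sup>2) \<longlonglongrightarrow> sum ?h F"
        by (intro tendsto_sum tendsto_power tendsto_norm blinfun.tendsto tendsto_diff tendsto_const A)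
      show "\<forall>\<^sub>F m in sequentially. (\<Sum>b\<in>F. (norm ((op_of (X n) - op_of (X m)) b))\<^sup>2) \<le> e\<^sup>2"
        using eventually_ge_at_top[of N]
      proof eventually_elim
        case (elim m)
        have "(\<Sum>b\<in>F. (norm (op_of (X n - X m) b))\<^sup>2) \<le> (norm (X n - X m))\<^sup>2"
          by (rule finite_sum_le_has_sum[OF norm_hs_has_sum[OF hs_basis] F]) simp
        also have "\<dots> \<le> e\<^sup>2" using N[OF elim] by (intro power_mono) (auto simp: dist_norm)
        finally show ?case by (simp add: minus_hs.rep_eq)
      qed
    qed simp
    have "?h summable_on hs_basis"
    proof (rule nonneg_bdd_above_summable_on)
      show "bdd_above (sum ?h ` {F. F \<subseteq> hs_basis \<and> finite F})"
        by (rule bdd_aboveI2[of _ _ "e\<^sup>2"]) (simp add: fin)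
    qed simp
    hence 1: "hilbert_schmidt (op_of (X n) - A)" by (rule hilbert_schmidtI[OF hs_basis])
    have 2: "norm D \<le> e" if D: "op_of D = op_of (X n) - A" for D
    proof -
      have hD: "(\<Sum>b\<in>F. (norm (op_of D b))\<^sup>2) \<le> e\<^sup>2" if "finite F" "F \<subseteq> hs_basis" for F
        unfolding D by (rule fin[OF that])
      have "(norm D)\<^sup>2 \<le> e\<^sup>2"
        by (rule has_sum_le_finite_sums[OF norm_hs_has_sum[OF hs_basis, of D]]) (rule hD)
      thus ?thesis using e by (rule power2_le_imp_le[OF _ less_imp_le])
    qed
    show ?thesis using 1 2 by blast
  qed
  obtain N where N: "\<And>m n. m \<ge> N \<Longrightarrow> n \<ge> N \<Longrightarrow> dist (X m) (X n) < 1"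
    using metric_CauchyD[OF C zero_less_one] by blast
  have "hilbert_schmidt (op_of (X N) - A)" using key[of 1 N N, OF zero_less_one N] by simp
  hence "hilbert_schmidt (op_of (X N) - (op_of (X N) - A))"
    using op_of[of "X N"] hilbert_schmidt_diff by blast
  hence "hilbert_schmidt A" by simp
  hence L: "op_of (Abs_hs A) = A" by (simp add: Abs_hs_inverse)
  define L where "L = Abs_hs A"
  note L = L[folded L_def]
  have "X \<longlonglongrightarrow> L"
    unfolding lim_sequentially
  proof (intro allI impI)
    fix r :: real assume "r > 0"
    then obtain N where N: "\<And>m n. m \<ge> N \<Longrightarrow> n \<ge> N \<Longrightarrow> dist (X m) (X n) < r/2"
      using metric_CauchyD[OF C, of "r/2"] by auto
    have "dist (X n) L < r" if n: "n \<ge> N" for n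
    proof -
      have "norm (X n - L) \<le> r/2"
        using key[of "r/2" N n, OF _ N[OF n]] \<open>r > 0\<close> by (simp add: minus_hs.rep_eq L)
      thus ?thesis using \<open>r > 0\<close> by (simp add: dist_norm)
    qed
    thus "\<exists>no. \<forall>n\<ge>no. dist (X n) L < r" by blast
  qed
  thus "convergent X" by (auto simp: convergent_def)
qed

lemma dense_imp_countable_subbasis:
  fixes D :: "'a::metric_space set"
  assumes D: "countable D" and dense: "closure D = UNIV"
  shows "\<exists>B::'a set set. countable B \<and> open = generate_topology B"
proof -
  let ?B = "(\<lambda>(d, n). ball d (1 / real (Suc n))) ` (D \<times> (UNIV::nat set))"
  have "topological_basis ?B"
  proof (rule topological_basisI)
    fix U and x :: 'a assume U: "open U" "x \<in> U"
    obtain e where e: "e > 0" "ball x e \<subseteq> U" using U openE by blast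
    obtain n where n: "1 / real (Suc n) < e/2" using nat_approx_posE[of "e/2"] e by auto
    have "x \<in> closure D" using dense by simp
    then obtain d where d: "d \<in> D" "dist d x < 1 / real (Suc n)"
      unfolding closure_approachable by (meson of_nat_0_less_iff zero_less_Suc zero_less_divide_1_iff)
    have "ball d (1 / real (Suc n)) \<subseteq> ball x e"
    proof
      fix y assume "y \<in> ball d (1 / real (Suc n))"
      thus "y \<in> ball x e" using d(2) n dist_triangle2[of x y d] by (simp add: dist_commute)
    qed
    thus "\<exists>B'\<in>?B. x \<in> B' \<and> B' \<subseteq> U" using d e by (intro bexI[of _ "ball d (1 / real (Suc n))"]) auto
  qed auto
  moreover have "countable ?B" using D by blast
  ultimately show ?thesis using topological_basis_imp_subbasis by blast
qed

lift_definition hs_rank_one :: "'a \<Rightarrow> 'a \<Rightarrow> 'a::separable_hilbert hs"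
  is "\<lambda>e d. Blinfun (\<lambda>x. inner x e *\<^sub>R d)"
proof -
  fix e d :: 'a
  have ap: "blinfun_apply (Blinfun (\<lambda>x. inner x e *\<^sub>R d)) x = inner x e *\<^sub>R d" for x
    by (subst bounded_linear_Blinfun_apply) (auto intro!: bounded_linear_intros)
  show "hilbert_schmidt (Blinfun (\<lambda>x. inner x e *\<^sub>R d))"
    by (rule hilbert_schmidtI[OF hs_basis])
       (use parseval[OF hs_basis, of e] in \<open>auto simp: ap power_mult_distrib inner_commute summable_on_def
          intro!: exI[of _ "(norm e)\<^sup>2 * (norm d)\<^sup>2"] has_sum_cmult_left\<close>)
qed

lemma hs_rank_one_apply: "blinfun_apply (op_of (hs_rank_one e d)) x = inner x e *\<^sub>R d"
  unfolding hs_rank_one.rep_eq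
  by (subst bounded_linear_Blinfun_apply) (auto intro!: bounded_linear_intros)

lemma op_of_sum_list: "op_of (sum_list xs) = sum_list (map op_of xs)"
  by (induction xs) (auto simp: zero_hs.rep_eq plus_hs.rep_eq)

lemma op_of_sum: "op_of (sum f A) = (\<Sum>x\<in>A. op_of (f x))"
  by (induction A rule: infinite_finite_induct) (auto simp: zero_hs.rep_eq plus_hs.rep_eq)

lemma hs_separable: "\<exists>D :: 'a::separable_hilbert hs set. countable D \<and> closure D = UNIV"
proof -
  let ?B = "hs_basis :: 'a set"
  have on: "orthonormal ?B" using hs_basis by (auto simp: orthonormal_basis_def)
  obtain C :: "'a set" where C: "countable C" "\<And>U. open U \<Longrightarrow> U \<noteq> {} \<Longrightarrow> \<exists>d\<in>C. d \<in> U"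
    using countable_dense_setE by metis
  let ?D = "(\<lambda>ps. sum_list (map (\<lambda>(e, d). hs_rank_one e d) ps)) ` lists (?B \<times> C)"
  have "countable ?D"
    using C(1) orthonormal_countable[OF on] by (intro countable_image countable_lists countable_SIGMA) auto
  moreover have "T \<in> closure ?D" for T :: "'a hs"
    unfolding closure_approachable
  proof (intro allI impI)
    fix r :: real assume r: "r > 0"
    obtain F where F: "finite F" "F \<subseteq> ?B"
      "\<And>Y. finite Y \<Longrightarrow> F \<subseteq> Y \<Longrightarrow> Y \<subseteq> ?B \<Longrightarrow> dist (\<Sum>e\<in>Y. (norm (op_of T e))\<^sup>2) ((norm T)\<^sup>2) < r\<^sup>2 / 4"
      using norm_hs_has_sum[OF hs_basis, of T, unfolded has_sum_metric, rule_format, of "r\<^sup>2/4"] r by auto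
    define \<delta> where "\<delta> = r\<^sup>2 / (4 * (real (card F) + 1))"
    have \<delta>: "\<delta> > 0" using r by (simp add: \<delta>_def)
    have "\<exists>d\<in>C. (norm (op_of T e - d))\<^sup>2 < \<delta>" for e
    proof -
      have "\<exists>d\<in>C. d \<in> ball (op_of T e) (sqrt \<delta>)" using C(2)[of "ball (op_of T e) (sqrt \<delta>)"] \<delta> by auto
      then obtain d where "d \<in> C" "norm (op_of T e - d) < sqrt \<delta>" by (auto simp: dist_norm)
      moreover from this have "(norm (op_of T e - d))\<^sup>2 < (sqrt \<delta>)\<^sup>2" by (intro power_strict_mono) auto
      ultimately show ?thesis using \<delta> by (intro bexI[of _ d]) simp_all
    qed
    then obtain d where d: "\<And>e. d e \<in> C" "\<And>e. (norm (op_of T e - d e))\<^sup>2 < \<delta>" by metis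
    let ?S = "\<Sum>e\<in>F. hs_rank_one e (d e)"
    have Sap: "op_of ?S e = (if e \<in> F then d e else 0)" if "e \<in> ?B" for e
    proof -
      have "op_of ?S e = (\<Sum>e'\<in>F. if e = e' then d e' else 0)"
        unfolding op_of_sum blinfun.sum_left
        using that F(2) by (intro sum.cong refl) (auto simp: hs_rank_one_apply orthonormal_inner[OF on] subset_iff)
      thus ?thesis using F(1) by simp
    qed
    obtain fs where fs: "set fs = F" "distinct fs" using finite_distinct_list[OF F(1)] by blast
    have "?S = sum_list (map (\<lambda>(e, d). hs_rank_one e d) (map (\<lambda>e. (e, d e)) fs))"
      using fs by (simp add: o_def sum_list_distinct_conv_sum_set)
    moreover have "map (\<lambda>e. (e, d e)) fs \<in> lists (?B \<times> C)" using fs F(2) d(1) by auto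
    ultimately have SD: "?S \<in> ?D" by (rule image_eqI)
    have "(norm (?S - T))\<^sup>2 \<le> r\<^sup>2 / 2"
    proof (rule has_sum_le_finite_sums[OF norm_hs_has_sum[OF hs_basis]])
      fix G assume G: "finite G" "G \<subseteq> ?B"
      let ?h = "\<lambda>e. (norm (op_of (?S - T) e))\<^sup>2"
      have GF: "G \<union> F = F \<union> (G - F)" by blast
      have "sum ?h G \<le> sum ?h (G \<union> F)"
        using G F by (intro sum_mono2) auto
      also have "\<dots> = sum ?h F + sum ?h (G - F)"
        unfolding GF by (rule sum.union_disjoint) (use G F in auto)
      also have "sum ?h F \<le> (\<Sum>e\<in>F. \<delta>)"
      proof (rule sum_mono)
        fix e assume e: "e \<in> F"
        hence "?h e = (norm (op_of T e - d e))\<^sup>2"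
          using F(2) by (auto simp: minus_hs.rep_eq blinfun.diff_left Sap norm_minus_commute)
        thus "?h e \<le> \<delta>" using d(2)[of e] by linarith
      qed
      also have "(\<Sum>e\<in>F. \<delta>) \<le> r\<^sup>2/4"
        using r by (simp add: \<delta>_def field_simps)
      also have "sum ?h (G - F) = (\<Sum>e\<in>G-F. (norm (op_of T e))\<^sup>2)"
        using G(2) by (intro sum.cong refl) (auto simp: minus_hs.rep_eq blinfun.diff_left Sap subset_iff)
      also have "\<dots> \<le> r\<^sup>2/4"
      proof -
        have "(\<Sum>e\<in>G\<union>F. (norm (op_of T e))\<^sup>2) = (\<Sum>e\<in>F. (norm (op_of T e))\<^sup>2) + (\<Sum>e\<in>G-F. (norm (op_of T e))\<^sup>2)"
          unfolding GF by (rule sum.union_disjoint) (use G F in auto)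
        moreover have "(\<Sum>e\<in>G\<union>F. (norm (op_of T e))\<^sup>2) \<le> (norm T)\<^sup>2"
          using G F by (intro finite_sum_le_has_sum[OF norm_hs_has_sum[OF hs_basis]]) auto
        moreover have "dist (\<Sum>e\<in>F. (norm (op_of T e))\<^sup>2) ((norm T)\<^sup>2) < r\<^sup>2 / 4"
          using F by blast
        ultimately show ?thesis unfolding dist_real_def by linarith
      qed
      finally show "sum ?h G \<le> r\<^sup>2 / 2" by simp
    qed
    also have "r\<^sup>2 / 2 < r\<^sup>2" using r by simp
    finally have "dist ?S T < r" using r by (simp add: dist_norm power2_less_imp_less)
    thus "\<exists>y\<in>?D. dist y T < r" using SD by blast
  qed
  ultimately show ?thesis by (intro exI[of _ ?D] conjI UNIV_eq_I[symmetric])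
qed

instance hs :: (separable_hilbert) second_countable_topology
proof
  obtain D :: "'a hs set" where "countable D" "closure D = UNIV" using hs_separable by blast
  thus "\<exists>B::'a hs set set. countable B \<and> open = generate_topology B"
    by (rule dense_imp_countable_subbasis)
qed

instance hs :: (separable_hilbert) separable_hilbert ..

text \<open>\<open>adjoint\<close> is the library's Hilbert space adjoint; \<open>inner_adjoint\<close> shows that it exists.\<close>

lift_definition hs_adjoint :: "'a::separable_hilbert hs \<Rightarrow> 'a hs"
  is "\<lambda>T. Blinfun (adjoint (blinfun_apply T))"
proof -
  fix T :: "'a \<Rightarrow>\<^sub>L 'a"
  assume T: "hilbert_schmidt T"
  have bl: "bounded_linear (blinfun_apply T)" by (rule blinfun.bounded_linear_right)
  obtain s where "((\<lambda>e. (norm (blinfun_apply T e))\<^sup>2) has_sum s) hs_basis"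
    using hilbert_schmidt_summable[OF T hs_basis] by (auto simp: summable_on_def)
  from has_sum_norm_adjoint[OF bl hs_basis hs_basis this]
  show "hilbert_schmidt (Blinfun (adjoint (blinfun_apply T)))"
    by (intro hilbert_schmidtI[OF hs_basis])
       (auto simp: bounded_linear_Blinfun_apply bounded_linear_adjoint[OF bl] summable_on_def)
qed

lemma hs_adjoint_apply: "blinfun_apply (op_of (hs_adjoint T)) = adjoint (blinfun_apply (op_of T))"
  unfolding hs_adjoint.rep_eq
  by (rule bounded_linear_Blinfun_apply[OF bounded_linear_adjoint[OF blinfun.bounded_linear_right]])

definition self_adjoint :: "'a::separable_hilbert hs \<Rightarrow> bool" where
  "self_adjoint T \<longleftrightarrow> hs_adjoint T = T"

subsection \<open>The exponential of a bounded operator\<close>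

text \<open>The library's \<open>exp\<close> needs a normed algebra, which the type of bounded operators is not an
  instance of.\<close>

definition blinfun_exp :: "('b::banach \<Rightarrow>\<^sub>L 'b) \<Rightarrow> 'b \<Rightarrow>\<^sub>L 'b" where
  "blinfun_exp A = (\<Sum>n. (1 / fact n) *\<^sub>R (blinfun_compose A ^^ n) id_blinfun)"

lemma norm_blinfun_funpow:
  fixes A :: "'b::real_normed_vector \<Rightarrow>\<^sub>L 'b"
  shows "norm ((blinfun_compose A ^^ n) id_blinfun) \<le> norm A ^ n"
proof (induction n)
  case 0
  show ?case using norm_blinfun_bound[of 1 id_blinfun] by simp
next
  case (Suc n)
  have "norm (A o\<^sub>L (blinfun_compose A ^^ n) id_blinfun) \<le> norm A * norm ((blinfun_compose A ^^ n) id_blinfun)"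
    by (rule norm_blinfun_compose)
  also have "\<dots> \<le> norm A * norm A ^ n" by (intro mult_left_mono Suc) simp
  finally show ?case by simp
qed

lemma summable_blinfun_exp:
  fixes A :: "'b::banach \<Rightarrow>\<^sub>L 'b"
  shows "summable (\<lambda>n. (1 / fact n) *\<^sub>R (blinfun_compose A ^^ n) id_blinfun)"
proof (rule summable_comparison_test)
  show "summable (\<lambda>n. inverse (fact n) * norm A ^ n)" by (rule summable_exp)
  show "\<exists>N. \<forall>n\<ge>N. norm ((1 / fact n) *\<^sub>R (blinfun_compose A ^^ n) id_blinfun) \<le> inverse (fact n) * norm A ^ n"
    using norm_blinfun_funpow[where A = A] by (auto simp: divide_inverse intro!: exI[of _ 0] mult_left_mono)
qed

subsection \<open>Square-integrable Levy processes\<close>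

text \<open>Only times \<open>t \<ge> 0\<close> matter: a filtration on \<open>[0, \<infinity>)\<close> extends to all real times by
  \<open>F t = F 0\<close> for \<open>t < 0\<close>. Paths are not required to be cadlag and the filtration is not required to
  satisfy the usual conditions.\<close>

locale levy_process = prob_space M + filtration "space M" F
  for M :: "'w measure" and F :: "real \<Rightarrow> 'w measure" +
  fixes L :: "real \<Rightarrow> 'w \<Rightarrow> 'b::{real_normed_vector, second_countable_topology}"
  assumes sets_F_subset: "t \<ge> 0 \<Longrightarrow> sets (F t) \<subseteq> sets M"
    and adapted: "t \<ge> 0 \<Longrightarrow> L t \<in> borel_measurable (F t)"
    and starts_at_0: "AE \<omega> in M. L 0 \<omega> = 0"
    and indep_increments: "0 \<le> s \<Longrightarrow> s \<le> t \<Longrightarrow>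
      indep_set (sets (F s)) {(\<lambda>\<omega>. L t \<omega> - L s \<omega>) -` A \<inter> space M | A. A \<in> sets borel}"
    and stationary_increments: "0 \<le> s \<Longrightarrow> s \<le> t \<Longrightarrow>
      distr M borel (\<lambda>\<omega>. L t \<omega> - L s \<omega>) = distr M borel (L (t - s))"
    and stochastically_continuous: "t \<ge> 0 \<Longrightarrow> \<epsilon> > 0 \<Longrightarrow>
      ((\<lambda>s. prob {\<omega> \<in> space M. dist (L s \<omega>) (L t \<omega>) > \<epsilon>}) \<longlongrightarrow> 0) (at t within {0..})"

locale square_integrable_levy_process = levy_process +
  assumes square_integrable: "t \<ge> 0 \<Longrightarrow> integrable M (\<lambda>\<omega>. (norm (L t \<omega>))\<^sup>2)"

subsection \<open>Stochastic integrals of deterministic operator-valued functions\<close>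

definition partition_upto :: "real \<Rightarrow> nat \<Rightarrow> (nat \<Rightarrow> real) \<Rightarrow> bool" where
  "partition_upto t n \<tau> \<longleftrightarrow> \<tau> 0 = 0 \<and> \<tau> n = t \<and> (\<forall>j<n. \<tau> j \<le> \<tau> (Suc j))"

definition step_integrand ::
  "nat \<Rightarrow> (nat \<Rightarrow> real) \<Rightarrow> (nat \<Rightarrow> 'b \<Rightarrow>\<^sub>L 'b) \<Rightarrow> real \<Rightarrow> 'b::real_normed_vector \<Rightarrow>\<^sub>L 'b" where
  "step_integrand n \<tau> A s = (\<Sum>j<n. indicator {\<tau> j<..\<tau> (Suc j)} s *\<^sub>R A j)"

definition step_integral ::
  "(real \<Rightarrow> 'w \<Rightarrow> 'b) \<Rightarrow> nat \<Rightarrow> (nat \<Rightarrow> real) \<Rightarrow> (nat \<Rightarrow> 'b \<Rightarrow>\<^sub>L 'b) \<Rightarrow> 'w \<Rightarrow> 'b::real_normed_vector" where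
  "step_integral L n \<tau> A \<omega> = (\<Sum>j<n. blinfun_apply (A j) (L (\<tau> (Suc j)) \<omega> - L (\<tau> j) \<omega>))"

text \<open>\<open>has_levy_integral M L t \<Phi> X\<close>: the random variable \<open>X\<close> is a version of \<open>\<integral>\<^sub>0\<^sup>t \<Phi>(s) dL(s)\<close>, i.e.
  the limit in \<open>L\<^sup>2(M)\<close> of the elementary integrals of step functions that approximate \<open>\<Phi>\<close> in
  \<open>L\<^sup>2([0,t])\<close> with respect to the operator norm. For a square-integrable Levy process
  the elementary integral is bounded in these norms, so \<open>X\<close> is determined up to a null
  set and does not depend on the approximating sequence.\<close>

definition has_levy_integral ::
  "'w measure \<Rightarrow> (real \<Rightarrow> 'w \<Rightarrow> 'b) \<Rightarrow> real \<Rightarrow> (real \<Rightarrow> 'b \<Rightarrow>\<^sub>L 'b) \<Rightarrow> ('w \<Rightarrow> 'b::real_normed_vector) \<Rightarrow> bool" where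
  "has_levy_integral M L t \<Phi> X \<longleftrightarrow>
     X \<in> borel_measurable M \<and>
     (\<exists>n \<tau> A. (\<forall>k. partition_upto t (n k) (\<tau> k)) \<and>
        (\<lambda>k. \<integral>\<^sup>+s\<in>{0..t}. ennreal ((norm (step_integrand (n k) (\<tau> k) (A k) s - \<Phi> s))\<^sup>2) \<partial>lborel)
          \<longlonglongrightarrow> 0 \<and>
        (\<lambda>k. \<integral>\<^sup>+\<omega>. ennreal ((norm (step_integral L (n k) (\<tau> k) (A k) \<omega> - X \<omega>))\<^sup>2) \<partial>M)
          \<longlonglongrightarrow> 0)"

text \<open>Mild solutions of \<open>dY(t) = C Y(t) dt + dL(t)\<close>, \<open>Y(0) = Y\<^sub>0\<close>; the second summand is a version of the
  stochastic convolution \<open>\<integral>\<^sub>0\<^sup>t exp((t - s) C) dL(s)\<close>.\<close>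

definition mild_solution ::
  "'w measure \<Rightarrow> (real \<Rightarrow> 'w \<Rightarrow> 'b) \<Rightarrow> ('b \<Rightarrow>\<^sub>L 'b) \<Rightarrow> 'b \<Rightarrow> (real \<Rightarrow> 'w \<Rightarrow> 'b::banach) \<Rightarrow> bool" where
  "mild_solution M L C Y0 Y \<longleftrightarrow>
     (\<forall>t\<ge>0. \<exists>I. has_levy_integral M L t (\<lambda>s. blinfun_exp ((t - s) *\<^sub>R C)) I \<and>
        (AE \<omega> in M. Y t \<omega> = blinfun_apply (blinfun_exp (t *\<^sub>R C)) Y0 + I \<omega>))"

end

theory Submission
  imports Defs
begin

text \<open>Let \<open>J\<close> be the adjoint map, an isometric linear involution of the Hilbert--Schmidt operators, and let
  \<open>P = (1 - J)/2\<close> and \<open>Q = (1 + J)/2\<close>. Since \<open>exp(sC)\<close> commutes with \<open>J\<close>, we have \<open>P exp(sC) Q = 0\<close>; since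
  the noise is self-adjoint, \<open>Q L(s) = L(s)\<close>. The step functions \<open>A\<^sub>k\<close> that approximate the integrand need
  not commute with \<open>J\<close>, but \<open>P \<integral>A\<^sub>k dL = \<integral>P A\<^sub>k Q dL\<close> and \<open>P A\<^sub>k Q\<close> tends to \<open>0\<close> in \<open>L\<^sup>2([0,t])\<close>. An estimate
  \<open>E\<parallel>\<integral>D dL\<parallel>\<^sup>2 \<le> K \<integral>\<parallel>D\<parallel>\<^sup>2 ds\<close> for step functions \<open>D\<close> then shows that \<open>P\<close> annihilates the stochastic
  convolution. The estimate splits \<open>L\<close> into its mean and a process with orthogonal increments, both of
  which grow at most linearly because they are additive in time.\<close>

section \<open>Linear growth of additive functions of time\<close>

text \<open>Boundedness near 0 does the work of continuity. A time \<open>t\<close> > 0 is cut into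
  \<open>k\<close> equal pieces \<open>u\<close>, and some multiple \<open>n * u\<close> falls into
  [\<delta>/2, \<delta>], so \<open>n * norm (g u)\<close> is at most \<open>B\<close>. Dividing by
  \<open>n\<close> bounds \<open>norm (g u)\<close> by \<open>2 * B / \<delta> * u\<close>, and
  summing the \<open>k\<close> pieces gives the same constant for \<open>t\<close>.\<close>

lemma additive_linear_bound:
  fixes g :: "real \<Rightarrow> 'b::real_normed_vector"
  assumes add: "\<And>s t. 0 \<le> s \<Longrightarrow> 0 \<le> t \<Longrightarrow> g (s + t) = g s + g t"
    and \<delta>: "\<delta> > 0" and bound: "\<And>t. 0 \<le> t \<Longrightarrow> t \<le> \<delta> \<Longrightarrow> norm (g t) \<le> B"
  shows "\<exists>K\<ge>0. \<forall>t\<ge>0. norm (g t) \<le> K * t"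
proof -
  have g0: "g 0 = 0" using add[of 0 0] by simp
  have B: "B \<ge> 0" using bound[of 0] \<delta> norm_ge_zero[of "g 0"] by linarith
  have mult: "g (real n * t) = real n *\<^sub>R g t" if "t \<ge> 0" for n t
    by (induction n) (use that in \<open>simp_all add: g0 add distrib_right scaleR_add_left\<close>)
  have "norm (g t) \<le> 2 * B / \<delta> * t" if t: "t \<ge> 0" for t
  proof (cases "t = 0")
    case False
    hence tp: "t > 0" using t by simp
    \<comment> \<open>The factor 2 makes the piece \<open>u\<close> = t/k at most
      \<delta>/2.\<close>
    obtain k :: nat where k: "2 * t / \<delta> < real k" using reals_Archimedean2 by blast
    hence kp: "real k > 0" using tp \<delta> by (meson less_trans divide_pos_pos mult_pos_pos zero_less_numeral)
    define u where "u = t / real k"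
    have u: "u > 0" "u \<le> \<delta> / 2" "t = real k * u"
      using tp kp k \<delta> by (auto simp: u_def field_simps)
    \<comment> \<open>\<open>n * u\<close> is the largest multiple of \<open>u\<close> not exceeding
      \<delta>; as \<open>u\<close> is at most \<delta>/2, it cannot fall below \<delta>/2.\<close>
    define n where "n = nat \<lfloor>\<delta> / u\<rfloor>"
    have "real n = of_int \<lfloor>\<delta> / u\<rfloor>" using \<delta> u by (simp add: n_def)
    hence "real n \<le> \<delta> / u" "\<delta> / u < real n + 1" by linarith+
    hence n: "real n * u \<le> \<delta>" "\<delta> < real n * u + u" using u by (simp_all add: field_simps)
    hence nu: "\<delta> / 2 \<le> real n * u" using u by linarith
    have "\<delta> / 2 * norm (g u) \<le> real n * u * norm (g u)" by (intro mult_right_mono nu) simp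
    also have "\<dots> = u * norm (g (real n * u))" using u by (simp add: mult)
    also have "\<dots> \<le> u * B" using u n by (intro mult_left_mono bound) auto
    finally have "norm (g u) \<le> 2 * B / \<delta> * u" using \<delta> by (simp add: field_simps)
    hence "real k * norm (g u) \<le> real k * (2 * B / \<delta> * u)" by (intro mult_left_mono) auto
    moreover have "norm (g t) = real k * norm (g u)" using u by (simp add: mult)
    ultimately show ?thesis using u(3) by (simp add: mult.left_commute mult.commute)
  qed (simp add: g0)
  thus ?thesis using B \<delta> by (intro exI[of _ "2 * B / \<delta>"]) auto
qed

section \<open>Square-integrable random variables\<close>

lemma power2_norm_add_le:
  fixes x y :: "'b::real_normed_vector"
  shows "(norm (x + y))\<^sup>2 \<le> 2 * (norm x)\<^sup>2 + 2 * (norm y)\<^sup>2"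
proof -
  have "(norm (x + y))\<^sup>2 \<le> (norm x + norm y)\<^sup>2" by (intro power_mono norm_triangle_ineq) simp
  thus ?thesis using sum_squares_bound[of "norm x" "norm y"] by (simp add: power2_sum)
qed

lemma nn_integral_power2_norm_add_le:
  fixes X Y :: "'w \<Rightarrow> 'b::{real_normed_vector, second_countable_topology}"
  assumes [measurable]: "X \<in> borel_measurable M" "Y \<in> borel_measurable M"
  shows "(\<integral>\<^sup>+\<omega>. ennreal ((norm (X \<omega> + Y \<omega>))\<^sup>2) \<partial>M)
    \<le> 2 * (\<integral>\<^sup>+\<omega>. ennreal ((norm (X \<omega>))\<^sup>2) \<partial>M) + 2 * (\<integral>\<^sup>+\<omega>. ennreal ((norm (Y \<omega>))\<^sup>2) \<partial>M)"
proof -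
  have "(\<integral>\<^sup>+\<omega>. ennreal ((norm (X \<omega> + Y \<omega>))\<^sup>2) \<partial>M)
    \<le> (\<integral>\<^sup>+\<omega>. 2 * ennreal ((norm (X \<omega>))\<^sup>2) + 2 * ennreal ((norm (Y \<omega>))\<^sup>2) \<partial>M)"
  proof (rule nn_integral_mono)
    fix \<omega>
    have "ennreal ((norm (X \<omega> + Y \<omega>))\<^sup>2) \<le> ennreal (2 * (norm (X \<omega>))\<^sup>2 + 2 * (norm (Y \<omega>))\<^sup>2)"
      by (intro ennreal_leI power2_norm_add_le)
    thus "ennreal ((norm (X \<omega> + Y \<omega>))\<^sup>2) \<le> 2 * ennreal ((norm (X \<omega>))\<^sup>2) + 2 * ennreal ((norm (Y \<omega>))\<^sup>2)"
      by (simp add: ennreal_plus ennreal_mult)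
  qed
  also have "\<dots> = 2 * (\<integral>\<^sup>+\<omega>. ennreal ((norm (X \<omega>))\<^sup>2) \<partial>M) + 2 * (\<integral>\<^sup>+\<omega>. ennreal ((norm (Y \<omega>))\<^sup>2) \<partial>M)"
    by (simp add: nn_integral_add nn_integral_cmult)
  finally show ?thesis .
qed

text \<open>Measurability is listed separately because integrability of the squared norm says
  nothing about measurability of \<open>X\<close> itself.\<close>

definition in_L2 :: "'w measure \<Rightarrow> ('w \<Rightarrow> 'b::real_normed_vector) \<Rightarrow> bool" where
  "in_L2 M X \<longleftrightarrow> X \<in> borel_measurable M \<and> integrable M (\<lambda>\<omega>. (norm (X \<omega>))\<^sup>2)"

lemma in_L2_measurable: "in_L2 M X \<Longrightarrow> X \<in> borel_measurable M"
  by (simp add: in_L2_def)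

lemma in_L2_add:
  fixes X Y :: "'w \<Rightarrow> 'b::{real_normed_vector, second_countable_topology}"
  assumes X: "in_L2 M X" and Y: "in_L2 M Y"
  shows "in_L2 M (\<lambda>\<omega>. X \<omega> + Y \<omega>)"
proof -
  have [measurable]: "X \<in> borel_measurable M" "Y \<in> borel_measurable M"
    using assms by (auto simp: in_L2_def)
  have "integrable M (\<lambda>\<omega>. 2 * (norm (X \<omega>))\<^sup>2 + 2 * (norm (Y \<omega>))\<^sup>2)"
    using assms by (auto simp: in_L2_def)
  hence "integrable M (\<lambda>\<omega>. (norm (X \<omega> + Y \<omega>))\<^sup>2)"
    by (rule Bochner_Integration.integrable_bound) (auto simp: power2_norm_add_le intro!: AE_I2 order_trans[OF power2_norm_add_le])
  thus ?thesis by (simp add: in_L2_def)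
qed

lemma in_L2_blinfun:
  assumes X: "in_L2 M X"
  shows "in_L2 M (\<lambda>\<omega>. blinfun_apply A (X \<omega>))"
proof -
  have X': "X \<in> borel_measurable M" "integrable M (\<lambda>\<omega>. (norm A)\<^sup>2 * (norm (X \<omega>))\<^sup>2)"
    using X by (auto simp: in_L2_def)
  have AX: "(\<lambda>\<omega>. blinfun_apply A (X \<omega>)) \<in> borel_measurable M"
    by (rule borel_measurable_continuous_on[OF _ X'(1)]) (intro continuous_intros)
  have "integrable M (\<lambda>\<omega>. (norm (blinfun_apply A (X \<omega>)))\<^sup>2)"
  proof (rule Bochner_Integration.integrable_bound[OF X'(2)])
    show "(\<lambda>\<omega>. (norm (blinfun_apply A (X \<omega>)))\<^sup>2) \<in> borel_measurable M"
      using AX by measurable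
    show "AE \<omega> in M. norm ((norm (blinfun_apply A (X \<omega>)))\<^sup>2) \<le> norm ((norm A)\<^sup>2 * (norm (X \<omega>))\<^sup>2)"
      using power_mono[OF norm_blinfun, of A _ 2] by (auto simp: power_mult_distrib)
  qed
  thus ?thesis using AX by (simp add: in_L2_def)
qed

lemma in_L2_diff:
  fixes X Y :: "'w \<Rightarrow> 'b::{real_normed_vector, second_countable_topology}"
  assumes X: "in_L2 M X" and Y: "in_L2 M Y"
  shows "in_L2 M (\<lambda>\<omega>. X \<omega> - Y \<omega>)"
  using in_L2_add[OF X in_L2_blinfun[OF Y, of "- id_blinfun"]] by (simp add: blinfun.minus_left)

lemma in_L2_0: "in_L2 M (\<lambda>_. 0)"
  by (simp add: in_L2_def)

lemma in_L2_inner_integrable: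
  fixes X Y :: "'w \<Rightarrow> 'b::{real_inner, second_countable_topology}"
  assumes X: "in_L2 M X" and Y: "in_L2 M Y"
  shows "integrable M (\<lambda>\<omega>. inner (X \<omega>) (Y \<omega>))"
proof -
  have [measurable]: "X \<in> borel_measurable M" "Y \<in> borel_measurable M"
    using assms by (auto simp: in_L2_def)
  have "integrable M (\<lambda>\<omega>. (norm (X \<omega>))\<^sup>2 + (norm (Y \<omega>))\<^sup>2)"
    using assms by (auto simp: in_L2_def)
  thus ?thesis
  proof (rule Bochner_Integration.integrable_bound)
    show "AE \<omega> in M. norm (inner (X \<omega>) (Y \<omega>)) \<le> norm ((norm (X \<omega>))\<^sup>2 + (norm (Y \<omega>))\<^sup>2)"
    proof (rule AE_I2)
      fix \<omega>
      have "0 \<le> norm (X \<omega>) * norm (Y \<omega>)" by simp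
      thus "norm (inner (X \<omega>) (Y \<omega>)) \<le> norm ((norm (X \<omega>))\<^sup>2 + (norm (Y \<omega>))\<^sup>2)"
        using Cauchy_Schwarz_ineq2[of "X \<omega>" "Y \<omega>"] sum_squares_bound[of "norm (X \<omega>)" "norm (Y \<omega>)"]
        unfolding real_norm_def by linarith
    qed
  qed measurable
qed

lemma in_L2_expectation_power2_norm_add:
  fixes X Y :: "'w \<Rightarrow> 'b::{real_inner, second_countable_topology}"
  assumes X: "in_L2 M X" and Y: "in_L2 M Y"
  shows "(\<integral>\<omega>. (norm (X \<omega> + Y \<omega>))\<^sup>2 \<partial>M)
    = (\<integral>\<omega>. (norm (X \<omega>))\<^sup>2 \<partial>M) + 2 * (\<integral>\<omega>. inner (X \<omega>) (Y \<omega>) \<partial>M) + (\<integral>\<omega>. (norm (Y \<omega>))\<^sup>2 \<partial>M)"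
proof -
  have "(norm (X \<omega> + Y \<omega>))\<^sup>2 = (norm (X \<omega>))\<^sup>2 + 2 * inner (X \<omega>) (Y \<omega>) + (norm (Y \<omega>))\<^sup>2" for \<omega>
    by (simp add: power2_norm_eq_inner inner_add_left inner_add_right inner_commute)
  thus ?thesis
    using X Y in_L2_inner_integrable[OF X Y] by (simp add: in_L2_def)
qed

lemma (in finite_measure) in_L2_const: "in_L2 M (\<lambda>_. c)"
  by (simp add: in_L2_def)

text \<open>Constants are integrable for a finite measure, and the norm is dominated by 1 plus its
  square.\<close>

lemma (in finite_measure) in_L2_integrable:
  fixes X :: "'a \<Rightarrow> 'b::{banach, second_countable_topology}"
  assumes "in_L2 M X" shows "integrable M X"
proof -
  have "integrable M (\<lambda>\<omega>. 1 + (norm (X \<omega>))\<^sup>2)" using assms by (simp add: in_L2_def)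
  thus ?thesis
  proof (rule Bochner_Integration.integrable_bound)
    have "x \<le> 1 + x\<^sup>2" for x :: real
      using sum_squares_bound[of x 1] zero_le_power2[of x] unfolding power_one mult_1_right by linarith
    thus "AE \<omega> in M. norm (X \<omega>) \<le> norm (1 + (norm (X \<omega>))\<^sup>2)"
      by (auto simp: abs_of_nonneg add_nonneg_nonneg)
  qed (use assms in \<open>simp add: in_L2_def\<close>)
qed

text \<open>By independence the joint law of \<open>X\<close> and \<open>Y\<close> is the product of
  their laws. Fubini integrates one variable at a time, and the inner product with a fixed vector
  commutes with the Bochner integral.\<close>

lemma (in prob_space) indep_var_expectation_inner:
  fixes X Y :: "'a \<Rightarrow> 'b::{real_inner, banach, second_countable_topology}"
  assumes indep: "indep_var borel X borel Y" and X: "in_L2 M X" and Y: "in_L2 M Y"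
  shows "expectation (\<lambda>\<omega>. inner (X \<omega>) (Y \<omega>)) = inner (expectation X) (expectation Y)"
proof -
  have [measurable]: "X \<in> borel_measurable M" "Y \<in> borel_measurable M"
    using X Y by (auto simp: in_L2_def)
  let ?P = "distr M borel X" and ?Q = "distr M borel Y"
  interpret P: prob_space ?P by (rule prob_space_distr) measurable
  interpret Q: prob_space ?Q by (rule prob_space_distr) measurable
  interpret PQ: pair_sigma_finite ?P ?Q ..
  have eq: "?P \<Otimes>\<^sub>M ?Q = distr M (borel \<Otimes>\<^sub>M borel) (\<lambda>\<omega>. (X \<omega>, Y \<omega>))"
    using indep by (simp add: indep_var_distribution_eq)
  \<comment> \<open>Fubini asks for integrability under the product law; pulled back to
    \<open>M\<close> it is integrability of the inner product of \<open>X\<close> and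
    \<open>Y\<close>, which follows from Cauchy-Schwarz.\<close>
  have int: "integrable (?P \<Otimes>\<^sub>M ?Q) (\<lambda>p. inner (fst p) (snd p))"
    unfolding eq by (subst integrable_distr_eq) (auto intro!: in_L2_inner_integrable X Y)
  have "expectation (\<lambda>\<omega>. inner (X \<omega>) (Y \<omega>)) = (\<integral>p. inner (fst p) (snd p) \<partial>(?P \<Otimes>\<^sub>M ?Q))"
    unfolding eq by (subst integral_distr) auto
  also have "\<dots> = (\<integral>x. \<integral>y. inner x y \<partial>?Q \<partial>?P)"
    using PQ.integral_fst'[OF int] by simp
  also have "\<dots> = (\<integral>x. inner x (expectation Y) \<partial>?P)"
  proof -
    have "integrable ?Q (\<lambda>y. y)" using in_L2_integrable[OF Y] by (subst integrable_distr_eq) auto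
    moreover have "(\<integral>y. y \<partial>?Q) = expectation Y" by (rule integral_distr) auto
    ultimately have "(\<integral>y. inner x y \<partial>?Q) = inner x (expectation Y)" for x
      using integral_inner_right[of x ?Q "\<lambda>y. y"] by simp
    thus ?thesis by (simp only:)
  qed
  also have "\<dots> = inner (expectation X) (expectation Y)"
  proof -
    have "integrable ?P (\<lambda>y. y)" using in_L2_integrable[OF X] by (subst integrable_distr_eq) auto
    moreover have "(\<integral>x. x \<partial>?P) = expectation X" by (rule integral_distr) auto
    ultimately show ?thesis using integral_inner_left[of "expectation Y" ?P "\<lambda>x. x"] by simp
  qed
  finally show ?thesis .
qed

section \<open>Step functions on partitions\<close>

lemma step_integral_add:
  "step_integral (\<lambda>t \<omega>. L t \<omega> + L' t \<omega>) n \<tau> D \<omega> = step_integral L n \<tau> D \<omega> + step_integral L' n \<tau> D \<omega>"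
  unfolding step_integral_def sum.distrib[symmetric] blinfun.add_right[symmetric] by (simp only: add_diff_add)

lemma step_integral_Suc:
  "step_integral L (Suc n) \<tau> D \<omega> = step_integral L n \<tau> D \<omega> + blinfun_apply (D n) (L (\<tau> (Suc n)) \<omega> - L (\<tau> n) \<omega>)"
  by (simp add: step_integral_def)

lemma partition_upto_mono:
  assumes "partition_upto t n \<tau>" "i \<le> j" "j \<le> n"
  shows "\<tau> i \<le> \<tau> j"
  using assms(2,3)
proof (induction rule: dec_induct)
  case (step k)
  moreover have "\<tau> k \<le> \<tau> (Suc k)" using assms(1) step.prems by (simp add: partition_upto_def)
  ultimately show ?case by simp
qed simp

text \<open>The intervals of the partition are disjoint and lie in [0,t]. At each \<open>s\<close>
  at most one summand is nonzero, and there it equals the squared norm of the step function; so the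
  inequality holds pointwise under the integral.\<close>

lemma sum_partition_le_nn_integral:
  fixes D :: "nat \<Rightarrow> 'b::real_normed_vector \<Rightarrow>\<^sub>L 'b"
  assumes p: "partition_upto t n \<tau>"
  shows "ennreal (\<Sum>j<n. (norm (D j))\<^sup>2 * (\<tau> (Suc j) - \<tau> j))
    \<le> (\<integral>\<^sup>+s\<in>{0..t}. ennreal ((norm (step_integrand n \<tau> D s))\<^sup>2) \<partial>lborel)"
proof -
  have le: "\<tau> j \<le> \<tau> (Suc j)" if "j < n" for j using p that by (simp add: partition_upto_def)
  have "ennreal (\<Sum>j<n. (norm (D j))\<^sup>2 * (\<tau> (Suc j) - \<tau> j))
      = (\<Sum>j<n. ennreal ((norm (D j))\<^sup>2) * emeasure lborel {\<tau> j<..\<tau> (Suc j)})"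
    by (subst sum_ennreal[symmetric]) (auto simp: le ennreal_mult intro!: sum.cong)
  also have "\<dots> = (\<integral>\<^sup>+s. (\<Sum>j<n. ennreal ((norm (D j))\<^sup>2) * indicator {\<tau> j<..\<tau> (Suc j)} s) \<partial>lborel)"
    by (subst nn_integral_sum) (auto simp: nn_integral_cmult_indicator)
  also have "\<dots> \<le> (\<integral>\<^sup>+s\<in>{0..t}. ennreal ((norm (step_integrand n \<tau> D s))\<^sup>2) \<partial>lborel)"
  proof (rule nn_integral_mono)
    fix s
    show "(\<Sum>j<n. ennreal ((norm (D j))\<^sup>2) * indicator {\<tau> j<..\<tau> (Suc j)} s)
      \<le> ennreal ((norm (step_integrand n \<tau> D s))\<^sup>2) * indicator {0..t} s"
    proof (cases "\<exists>i<n. s \<in> {\<tau> i<..\<tau> (Suc i)}")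
      case True
      then obtain i where i: "i < n" "s \<in> {\<tau> i<..\<tau> (Suc i)}" by blast
      \<comment> \<open>The intervals are open on the left, so even neighbouring ones do not meet,
        and degenerate ones are empty.\<close>
      have uniq: "s \<in> {\<tau> j<..\<tau> (Suc j)} \<longleftrightarrow> j = i" if "j < n" for j
        using i that partition_upto_mono[OF p, of "Suc i" j] partition_upto_mono[OF p, of "Suc j" i]
        by (cases i j rule: linorder_cases) auto
      have "0 \<le> \<tau> i" "\<tau> (Suc i) \<le> t"
        using partition_upto_mono[OF p, of 0 i] partition_upto_mono[OF p, of "Suc i" n] i p
        by (auto simp: partition_upto_def)
      hence s: "s \<in> {0..t}" using i by auto
      have "(\<Sum>j<n. ennreal ((norm (D j))\<^sup>2) * indicator {\<tau> j<..\<tau> (Suc j)} s)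
          = (\<Sum>j<n. if j = i then ennreal ((norm (D i))\<^sup>2) else 0)"
        by (intro sum.cong refl) (auto simp: indicator_def uniq simp del: greaterThanAtMost_iff)
      moreover have "step_integrand n \<tau> D s = (\<Sum>j<n. if j = i then D i else 0)"
        unfolding step_integrand_def
        by (intro sum.cong refl) (auto simp: indicator_def uniq simp del: greaterThanAtMost_iff)
      ultimately show ?thesis using i s by simp
    next
      case False
      hence "(\<Sum>j<n. ennreal ((norm (D j))\<^sup>2) * indicator {\<tau> j<..\<tau> (Suc j)} s) = 0"
        by (intro sum.neutral) (auto simp: indicator_def)
      thus ?thesis by simp
    qed
  qed
  finally show ?thesis .
qed

section \<open>Mean and variance of a Hilbert space valued process\<close>

text \<open>Values in a separable Hilbert space provide an inner product, to express orthogonality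
  of increments, and the completeness that Bochner expectations require.\<close>

locale hilbert_levy_process = square_integrable_levy_process M F L
  for M :: "'w measure" and F :: "real \<Rightarrow> 'w measure"
    and L :: "real \<Rightarrow> 'w \<Rightarrow> 'b::separable_hilbert"
begin

definition mean_at :: "real \<Rightarrow> 'b" where "mean_at t = expectation (L t)"

definition compensated :: "real \<Rightarrow> 'w \<Rightarrow> 'b" where "compensated t \<omega> = L t \<omega> - mean_at t"

text \<open>For \<open>t\<close> \<ge> 0 this is the trace of the covariance operator of
  \<open>L t\<close>.\<close>

definition var_at :: "real \<Rightarrow> real" where "var_at t = expectation (\<lambda>\<omega>. (norm (compensated t \<omega>))\<^sup>2)"

lemma measurable_F: "t \<ge> 0 \<Longrightarrow> X \<in> borel_measurable (F t) \<Longrightarrow> X \<in> borel_measurable M"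
  using measurable_mono[OF order_refl refl sets_F_subset, of t borel] space_F by blast

lemma measurable_F_mono: "s \<le> t \<Longrightarrow> X \<in> borel_measurable (F s) \<Longrightarrow> X \<in> borel_measurable (F t)"
  using measurable_mono[OF order_refl refl sets_F_mono, of s t borel] space_F by blast

lemma L_in_L2: "t \<ge> 0 \<Longrightarrow> in_L2 M (L t)"
  using square_integrable measurable_F[OF _ adapted] by (simp add: in_L2_def)

lemma L_integrable: "t \<ge> 0 \<Longrightarrow> integrable M (L t)"
  by (intro in_L2_integrable L_in_L2)

lemma compensated_in_L2: "t \<ge> 0 \<Longrightarrow> in_L2 M (compensated t)"
  unfolding compensated_def[abs_def] by (intro in_L2_diff L_in_L2 in_L2_const)

lemma compensated_adapted: "t \<ge> 0 \<Longrightarrow> compensated t \<in> borel_measurable (F t)"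
  unfolding compensated_def[abs_def] using adapted[of t] by simp

text \<open>Both sides are integrals of \<open>f\<close> against the same law, by stationarity of
  the increments.\<close>

lemma expectation_increment:
  fixes f :: "'b \<Rightarrow> 'c::{banach, second_countable_topology}"
  assumes "0 \<le> s" "s \<le> t" "f \<in> borel_measurable borel"
  shows "expectation (\<lambda>\<omega>. f (L t \<omega> - L s \<omega>)) = expectation (\<lambda>\<omega>. f (L (t - s) \<omega>))"
proof -
  have m: "L u \<in> borel_measurable M" if "u \<ge> 0" for u using L_in_L2[OF that] by (simp add: in_L2_def)
  have "expectation (\<lambda>\<omega>. f (L t \<omega> - L s \<omega>)) = (\<integral>x. f x \<partial>distr M borel (\<lambda>\<omega>. L t \<omega> - L s \<omega>))"
    using m assms by (subst integral_distr) auto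
  also have "\<dots> = expectation (\<lambda>\<omega>. f (L (t - s) \<omega>))"
    unfolding stationary_increments[OF assms(1,2)] using m assms by (subst integral_distr) auto
  finally show ?thesis .
qed

lemma mean_at_diff:
  assumes "0 \<le> s" "s \<le> t"
  shows "mean_at t - mean_at s = mean_at (t - s)"
  using expectation_increment[OF assms, of "\<lambda>x. x"] assms L_integrable by (simp add: mean_at_def)

lemma mean_at_add: "0 \<le> s \<Longrightarrow> 0 \<le> t \<Longrightarrow> mean_at (s + t) = mean_at s + mean_at t"
  using mean_at_diff[of s "s + t"] by (simp add: algebra_simps)

text \<open>Presents the centred increment as a fixed translate of the increment of
  \<open>L\<close>, so that independence and stationarity carry over to
  \<open>compensated\<close>.\<close>

lemma compensated_increment:
  "0 \<le> s \<Longrightarrow> s \<le> t \<Longrightarrow> compensated t \<omega> - compensated s \<omega> = L t \<omega> - L s \<omega> - mean_at (t - s)"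
  by (simp add: compensated_def mean_at_diff[symmetric])

lemma expectation_compensated_increment:
  assumes "0 \<le> s" "s \<le> t"
  shows "expectation (\<lambda>\<omega>. compensated t \<omega> - compensated s \<omega>) = 0"
proof -
  have "expectation (\<lambda>\<omega>. compensated t \<omega> - compensated s \<omega>) = expectation (L t) - expectation (L s) - mean_at (t - s)"
    using assms L_integrable by (simp add: compensated_increment prob_space)
  thus ?thesis using mean_at_diff[OF assms] by (simp add: mean_at_def)
qed

lemma var_compensated_increment:
  assumes "0 \<le> s" "s \<le> t"
  shows "expectation (\<lambda>\<omega>. (norm (compensated t \<omega> - compensated s \<omega>))\<^sup>2) = var_at (t - s)"
  using expectation_increment[OF assms, of "\<lambda>x. (norm (x - mean_at (t - s)))\<^sup>2"] assms
  by (simp add: compensated_increment var_at_def compensated_def[of "t - s"])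

text \<open>The second argument is a Borel function \<open>f\<close> of the increment of
  \<open>L\<close>, hence independent of the past and so of \<open>W\<close>. The expectation of the
  inner product therefore factorises, and the second factor is \<open>D\<close> applied to the zero
  mean of the centred increment.\<close>

lemma increment_orthogonal:
  fixes W :: "'w \<Rightarrow> 'b" and D :: "'b \<Rightarrow>\<^sub>L 'b"
  assumes st: "0 \<le> s" "s \<le> t" and WF: "W \<in> borel_measurable (F s)" and W: "in_L2 M W"
  shows "expectation (\<lambda>\<omega>. inner (W \<omega>) (D (compensated t \<omega> - compensated s \<omega>))) = 0"
proof -
  define f where "f x = D (x - mean_at (t - s))" for x
  have f: "f \<in> borel_measurable borel"
    unfolding f_def[abs_def] by (intro borel_measurable_continuous_onI continuous_intros)
  let ?Z = "\<lambda>\<omega>. L t \<omega> - L s \<omega>"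
  have Zm: "?Z \<in> borel_measurable M"
    using in_L2_measurable[OF L_in_L2, of s] in_L2_measurable[OF L_in_L2, of t] st by simp
  have "indep_var borel W borel ?Z"
    unfolding indep_var_def indep_vars_def2
  proof (intro conjI ballI)
    show "random_variable (case_bool borel borel i) (case_bool W ?Z i)" for i
      using Zm in_L2_measurable[OF W] by (cases i) simp_all
    \<comment> \<open>Preimages under \<open>W\<close> belong to \<open>F s\<close>, so both
      families lie inside those that \<open>indep_increments\<close> makes independent.\<close>
    show "indep_sets (\<lambda>i. {case_bool W ?Z i -` A \<inter> space M | A. A \<in> sets (case_bool borel borel i)}) UNIV"
    proof (rule indep_sets_mono_sets[OF indep_increments[OF st, unfolded indep_set_def]])
      fix i
      show "{case_bool W ?Z i -` A \<inter> space M | A. A \<in> sets (case_bool borel borel i)}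
        \<subseteq> case_bool (sets (F s)) {?Z -` A \<inter> space M | A. A \<in> sets borel} i"
        using measurable_sets[OF WF] by (cases i) (auto simp: space_F)
    qed
  qed
  from indep_var_compose[OF this, of "\<lambda>x. x" borel f borel] f
  have indep: "indep_var borel W borel (\<lambda>\<omega>. f (?Z \<omega>))" by (simp add: o_def)
  have eq: "f (?Z \<omega>) = D (compensated t \<omega> - compensated s \<omega>)" for \<omega>
    using st by (simp add: f_def compensated_increment)
  have L2: "in_L2 M (\<lambda>\<omega>. compensated t \<omega> - compensated s \<omega>)"
    using st by (intro in_L2_diff compensated_in_L2) auto
  have "expectation (\<lambda>\<omega>. inner (W \<omega>) (f (?Z \<omega>))) = inner (expectation W) (expectation (\<lambda>\<omega>. f (?Z \<omega>)))"
    by (rule indep_var_expectation_inner[OF indep W]) (unfold eq, intro in_L2_blinfun L2)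
  also have "expectation (\<lambda>\<omega>. f (?Z \<omega>)) = D (expectation (\<lambda>\<omega>. compensated t \<omega> - compensated s \<omega>))"
    unfolding eq by (rule integral_bounded_linear[OF blinfun.bounded_linear_right in_L2_integrable[OF L2]])
  finally show ?thesis using st by (simp add: eq expectation_compensated_increment blinfun.zero_right)
qed

lemma var_at_nonneg: "var_at t \<ge> 0"
  by (simp add: var_at_def)

text \<open>Pythagoras: the increment after time \<open>s\<close> is orthogonal to
  \<open>compensated s\<close>, and by stationarity its second moment is
  \<open>var_at t\<close>.\<close>

lemma var_at_add:
  assumes "0 \<le> s" "0 \<le> t"
  shows "var_at (s + t) = var_at s + var_at t"
proof -
  let ?D = "\<lambda>\<omega>. compensated (s + t) \<omega> - compensated s \<omega>"
  have "var_at (s + t) = expectation (\<lambda>\<omega>. (norm (compensated s \<omega> + ?D \<omega>))\<^sup>2)"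
    by (simp add: var_at_def)
  also have "\<dots> = var_at s + 2 * expectation (\<lambda>\<omega>. inner (compensated s \<omega>) (?D \<omega>)) + var_at t"
    using assms var_compensated_increment[of s "s + t"]
    by (subst in_L2_expectation_power2_norm_add)
       (auto simp: var_at_def intro!: in_L2_diff compensated_in_L2)
  also have "expectation (\<lambda>\<omega>. inner (compensated s \<omega>) (?D \<omega>)) = 0"
    using increment_orthogonal[of s "s + t" "compensated s" id_blinfun] assms
      compensated_adapted[of s] compensated_in_L2[of s] by simp
  finally show ?thesis by simp
qed

text \<open>A nonnegative additive function is monotone, so \<open>var_at\<close> is bounded by
  \<open>var_at 1\<close> on [0,1] and grows linearly.\<close>

lemma var_at_linear_bound: "\<exists>K\<ge>0. \<forall>t\<ge>0. var_at t \<le> K * t"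
proof -
  have "norm (var_at t) \<le> var_at 1" if "0 \<le> t" "t \<le> 1" for t
    using var_at_add[of t "1 - t"] var_at_nonneg[of "1 - t"] var_at_nonneg[of t] that by simp
  from additive_linear_bound[of var_at 1 "var_at 1", OF var_at_add _ this]
  show ?thesis using var_at_nonneg by simp
qed

text \<open>The mean is bounded near \<open>0\<close>: for small \<open>t\<close> both \<open>\<parallel>L t\<parallel> \<le> 1\<close> and \<open>\<parallel>compensated t\<parallel> < 1\<close> hold with
  positive probability, by stochastic continuity and by Markov's inequality.\<close>

lemma mean_at_linear_bound: "\<exists>K\<ge>0. \<forall>t\<ge>0. norm (mean_at t) \<le> K * t"
proof -
  obtain K where K: "K \<ge> 0" "\<And>t. t \<ge> 0 \<Longrightarrow> var_at t \<le> K * t" using var_at_linear_bound by blast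
  let ?A = "\<lambda>t. {\<omega> \<in> space M. dist (L t \<omega>) (L 0 \<omega>) > 1}"
  let ?B = "\<lambda>t. {\<omega> \<in> space M. (norm (compensated t \<omega>))\<^sup>2 \<ge> 1}"
  have "\<forall>\<^sub>F t in at 0 within {0..}. prob (?A t) < 1/2"
    using order_tendstoD(2)[OF stochastically_continuous[of 0 1], of "1/2"] by simp
  then obtain d where d: "d > 0" "\<And>t. t > 0 \<Longrightarrow> t < d \<Longrightarrow> prob (?A t) < 1/2"
    unfolding eventually_at by (auto simp: dist_real_def)
  \<comment> \<open>The first entry keeps \<delta> below \<open>d\<close>. The second makes the
    variance on [0, \<delta>] at most K/(4(K+1)), hence less than 1/2; adding 1 to \<open>K\<close>
    covers \<open>K\<close> = 0.\<close>
  define \<delta> where "\<delta> = min (d / 2) (1 / (4 * (K + 1)))"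
  have \<delta>: "\<delta> > 0" "\<delta> < d" using d K by (auto simp: \<delta>_def)
  have "norm (mean_at t) \<le> 2" if t: "0 \<le> t" "t \<le> \<delta>" for t
  \<comment> \<open>The limit only controls times different from 0; at 0 additivity forces the mean
    to vanish.\<close>
  proof (cases "t = 0")
    case True
    thus ?thesis using mean_at_add[of 0 0] by simp
  next
    case False
    have [measurable]: "L t \<in> borel_measurable M" "L 0 \<in> borel_measurable M" "compensated t \<in> borel_measurable M"
      using t by (auto intro!: in_L2_measurable L_in_L2 compensated_in_L2)
    have "prob (?B t) \<le> var_at t / 1"
      unfolding var_at_def
      by (rule integral_Markov_inequality_measure[where A = "space M"])
         (use compensated_in_L2[OF t(1)] in \<open>auto simp: in_L2_def\<close>)
    also have "\<dots> \<le> K * (1 / (4 * (K + 1)))"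
      using K t order_trans[OF K(2)[OF t(1)] mult_left_mono[of t "1 / (4 * (K + 1))" K]] by (simp add: \<delta>_def)
    also have "\<dots> < 1/2" using K by (simp add: field_simps)
    finally have B: "prob (?B t) < 1/2" .
    have A: "prob (?A t) < 1/2" using False t \<delta> by (intro d) auto
    show ?thesis
    proof (rule ccontr)
      assume m: "\<not> norm (mean_at t) \<le> 2"
      \<comment> \<open>Outside both events the mean, which is \<open>L t\<close> minus
        \<open>compensated t\<close>, would have norm less than 2. Since \<open>L 0\<close> vanishes
        almost surely, \<open>?A t\<close> does control the norm of \<open>L t\<close>.\<close>
      have "AE \<omega> in M. \<omega> \<in> ?A t \<union> ?B t"
        using starts_at_0 AE_space
      proof eventually_elim
        case (elim \<omega>)
        show ?case
        proof (rule ccontr)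
          assume "\<omega> \<notin> ?A t \<union> ?B t"
          hence "norm (L t \<omega>) \<le> 1" "(norm (compensated t \<omega>))\<^sup>2 < 1" using elim by auto
          moreover from this(2) have "norm (compensated t \<omega>) < 1"
            using power2_less_imp_less[of "norm (compensated t \<omega>)" 1] by simp
          moreover have "norm (mean_at t) \<le> norm (L t \<omega>) + norm (compensated t \<omega>)"
            using norm_triangle_ineq4[of "L t \<omega>" "compensated t \<omega>"] by (simp add: compensated_def)
          ultimately show False using m by linarith
        qed
      qed
      hence "prob (?A t \<union> ?B t) = 1" by (subst prob_eq_1) auto
      thus False using A B measure_Un_le[of "?A t" M "?B t"] by auto
    qed
  qed
  from additive_linear_bound[OF mean_at_add \<delta>(1) this] show ?thesis by simp
qed

section \<open>Mean-square estimate for elementary integrals\<close>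

text \<open>Induction on the number of intervals. The last summand is orthogonal to the sum of the
  earlier ones, which is measurable at the left end of the last interval, so the second moments add
  up.\<close>

lemma step_integral_compensated:
  fixes D :: "nat \<Rightarrow> 'b \<Rightarrow>\<^sub>L 'b"
  assumes "partition_upto t n \<tau>"
  shows "step_integral compensated n \<tau> D \<in> borel_measurable (F t)"
    and "in_L2 M (step_integral compensated n \<tau> D)"
    and "expectation (\<lambda>\<omega>. (norm (step_integral compensated n \<tau> D \<omega>))\<^sup>2)
      \<le> (\<Sum>j<n. (norm (D j))\<^sup>2 * var_at (\<tau> (Suc j) - \<tau> j))"
proof -
  \<comment> \<open>The three claims are proved together because the orthogonality in the induction
    step uses the first two for the shorter sum.\<close>
  have "step_integral compensated n \<tau> D \<in> borel_measurable (F t) \<and>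
    in_L2 M (step_integral compensated n \<tau> D) \<and>
    expectation (\<lambda>\<omega>. (norm (step_integral compensated n \<tau> D \<omega>))\<^sup>2)
      \<le> (\<Sum>j<n. (norm (D j))\<^sup>2 * var_at (\<tau> (Suc j) - \<tau> j))"
    using assms
  \<comment> \<open>\<open>t\<close> must vary, since the first \<open>n\<close> intervals partition
    only the time up to \<open>\<tau> n\<close>.\<close>
  proof (induction n arbitrary: t)
    case 0
    have "step_integral compensated 0 \<tau> D = (\<lambda>_. 0)" by (simp add: step_integral_def fun_eq_iff)
    thus ?case by (simp add: in_L2_0)
  next
    case (Suc n)
    let ?S = "step_integral compensated n \<tau> D"
    let ?N = "\<lambda>\<omega>. compensated t \<omega> - compensated (\<tau> n) \<omega>"
    let ?Z = "\<lambda>\<omega>. D n (?N \<omega>)"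
    have "partition_upto (\<tau> n) n \<tau>" and t: "\<tau> (Suc n) = t" "\<tau> n \<le> t" "0 \<le> \<tau> n"
      using Suc.prems partition_upto_mono[OF Suc.prems, of 0 n] by (auto simp: partition_upto_def)
    note IH = Suc.IH[OF this(1)]
    have eq: "step_integral compensated (Suc n) \<tau> D = (\<lambda>\<omega>. ?S \<omega> + ?Z \<omega>)"
      by (simp add: fun_eq_iff step_integral_Suc t)
    have N: "in_L2 M ?N" using t by (intro in_L2_diff compensated_in_L2) auto
    have Z: "in_L2 M ?Z" by (intro in_L2_blinfun N)
    have "?N \<in> borel_measurable (F t)"
      using t by (intro borel_measurable_diff compensated_adapted measurable_F_mono[OF t(2) compensated_adapted]) auto
    hence "?Z \<in> borel_measurable (F t)"
      by (rule borel_measurable_continuous_on[rotated]) (intro continuous_intros)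
    hence 1: "(\<lambda>\<omega>. ?S \<omega> + ?Z \<omega>) \<in> borel_measurable (F t)"
      using IH measurable_F_mono[OF t(2)] by (intro borel_measurable_add) auto
    have "expectation (\<lambda>\<omega>. (norm (?Z \<omega>))\<^sup>2) \<le> expectation (\<lambda>\<omega>. (norm (D n))\<^sup>2 * (norm (?N \<omega>))\<^sup>2)"
      using Z N power_mono[OF norm_blinfun, of "D n" _ 2]
      by (intro integral_mono) (auto simp: in_L2_def power_mult_distrib)
    also have "\<dots> = (norm (D n))\<^sup>2 * var_at (\<tau> (Suc n) - \<tau> n)"
      using t by (simp add: var_compensated_increment)
    finally have "expectation (\<lambda>\<omega>. (norm (?Z \<omega>))\<^sup>2) \<le> (norm (D n))\<^sup>2 * var_at (\<tau> (Suc n) - \<tau> n)" .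
    moreover have "expectation (\<lambda>\<omega>. inner (?S \<omega>) (?Z \<omega>)) = 0"
      using IH t by (intro increment_orthogonal) auto
    ultimately have "expectation (\<lambda>\<omega>. (norm (?S \<omega> + ?Z \<omega>))\<^sup>2)
        \<le> (\<Sum>j<Suc n. (norm (D j))\<^sup>2 * var_at (\<tau> (Suc j) - \<tau> j))"
      using IH Z by (subst in_L2_expectation_power2_norm_add) auto
    thus ?case unfolding eq using 1 in_L2_add[OF _ Z, of ?S] IH by blast
  qed
  thus "step_integral compensated n \<tau> D \<in> borel_measurable (F t)"
    and "in_L2 M (step_integral compensated n \<tau> D)"
    and "expectation (\<lambda>\<omega>. (norm (step_integral compensated n \<tau> D \<omega>))\<^sup>2)
      \<le> (\<Sum>j<n. (norm (D j))\<^sup>2 * var_at (\<tau> (Suc j) - \<tau> j))" by blast+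
qed

text \<open>The mean is Lipschitz in time with constant \<open>K\<close>, so the deterministic
  integral is at most \<open>K\<close> times the integral of the norm of the step function;
  Cauchy-Schwarz on [0,t] contributes the factor \<open>t\<close>.\<close>

lemma step_integral_mean_bound:
  fixes D :: "nat \<Rightarrow> 'b \<Rightarrow>\<^sub>L 'b"
  assumes p: "partition_upto t n \<tau>" and K: "K \<ge> 0" "\<And>t. t \<ge> 0 \<Longrightarrow> norm (mean_at t) \<le> K * t"
  shows "(norm (step_integral (\<lambda>t \<omega>. mean_at t) n \<tau> D \<omega>))\<^sup>2
    \<le> K\<^sup>2 * t * (\<Sum>j<n. (norm (D j))\<^sup>2 * (\<tau> (Suc j) - \<tau> j))"
proof -
  let ?\<Delta> = "\<lambda>j. \<tau> (Suc j) - \<tau> j"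
  have \<Delta>: "?\<Delta> j \<ge> 0" "\<tau> j \<ge> 0" if "j < n" for j
    using partition_upto_mono[OF p, of j "Suc j"] partition_upto_mono[OF p, of 0 j] p that
    by (auto simp: partition_upto_def)
  have "norm (step_integral (\<lambda>t \<omega>. mean_at t) n \<tau> D \<omega>) \<le> (\<Sum>j<n. norm (D j) * (K * ?\<Delta> j))"
    unfolding step_integral_def
  proof (rule sum_norm_le)
    fix j assume "j \<in> {..<n}"
    hence j: "j < n" by simp
    have "norm (D j (mean_at (\<tau> (Suc j)) - mean_at (\<tau> j))) \<le> norm (D j) * norm (mean_at (?\<Delta> j))"
      using \<Delta>[OF j] by (simp add: mean_at_diff norm_blinfun)
    also have "\<dots> \<le> norm (D j) * (K * ?\<Delta> j)" using \<Delta>[OF j] by (intro mult_left_mono K) auto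
    finally show "norm (D j (mean_at (\<tau> (Suc j)) - mean_at (\<tau> j))) \<le> norm (D j) * (K * ?\<Delta> j)" .
  qed
  hence "(norm (step_integral (\<lambda>t \<omega>. mean_at t) n \<tau> D \<omega>))\<^sup>2 \<le> (\<Sum>j<n. norm (D j) * (K * ?\<Delta> j))\<^sup>2"
    by (rule power_mono) simp
  \<comment> \<open>Each length is split into two square roots, so that one factor of Cauchy-Schwarz
    sums to the total length \<open>t\<close>.\<close>
  also have "(\<Sum>j<n. norm (D j) * (K * ?\<Delta> j)) = K * (\<Sum>j<n. (norm (D j) * sqrt (?\<Delta> j)) * sqrt (?\<Delta> j))"
    unfolding sum_distrib_left using \<Delta> by (intro sum.cong refl) (simp add: mult_ac)
  also have "\<dots>\<^sup>2 \<le> K\<^sup>2 * ((\<Sum>j<n. (norm (D j) * sqrt (?\<Delta> j))\<^sup>2) * (\<Sum>j<n. (sqrt (?\<Delta> j))\<^sup>2))"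
    unfolding power_mult_distrib[of K] by (intro mult_left_mono Cauchy_Schwarz_ineq_sum) simp
  also have "(\<Sum>j<n. (norm (D j) * sqrt (?\<Delta> j))\<^sup>2) = (\<Sum>j<n. (norm (D j))\<^sup>2 * ?\<Delta> j)"
    using \<Delta> by (intro sum.cong refl) (simp add: power_mult_distrib)
  also have "(\<Sum>j<n. (sqrt (?\<Delta> j))\<^sup>2) = (\<Sum>j<n. ?\<Delta> j)"
    using \<Delta> by (intro sum.cong refl) simp
  also have "\<dots> = t" using p by (simp add: sum_lessThan_telescope partition_upto_def)
  finally show ?thesis by (simp add: mult_ac)
qed

lemma step_integral_in_L2:
  fixes D :: "nat \<Rightarrow> 'b \<Rightarrow>\<^sub>L 'b"
  assumes p: "partition_upto t n \<tau>"
  shows "in_L2 M (step_integral L n \<tau> D)"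
proof -
  have "in_L2 M (\<lambda>\<omega>. step_integral compensated n \<tau> D \<omega> + step_integral (\<lambda>t \<omega>. mean_at t) n \<tau> D \<omega>)"
    by (intro in_L2_add step_integral_compensated(2)[OF p]) (simp add: step_integral_def in_L2_const)
  thus ?thesis unfolding step_integral_add[symmetric] by (simp add: compensated_def)
qed

text \<open>Continuity of the elementary integral from \<open>L\<^sup>2([0,t])\<close> to
  \<open>L\<^sup>2(M)\<close>. The constant is uniform in the partition and in the operators, which
  lets it be applied along a sequence of step functions.\<close>

lemma step_integral_bound:
  assumes t: "t \<ge> 0"
  shows "\<exists>K. \<forall>n \<tau> (D :: nat \<Rightarrow> 'b \<Rightarrow>\<^sub>L 'b). partition_upto t n \<tau> \<longrightarrow>
    (\<integral>\<^sup>+\<omega>. ennreal ((norm (step_integral L n \<tau> D \<omega>))\<^sup>2) \<partial>M)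
      \<le> ennreal K * (\<integral>\<^sup>+s\<in>{0..t}. ennreal ((norm (step_integrand n \<tau> D s))\<^sup>2) \<partial>lborel)"
proof -
  obtain V where V: "V \<ge> 0" "\<And>t. t \<ge> 0 \<Longrightarrow> var_at t \<le> V * t" using var_at_linear_bound by blast
  obtain K where K: "K \<ge> 0" "\<And>t. t \<ge> 0 \<Longrightarrow> norm (mean_at t) \<le> K * t" using mean_at_linear_bound by blast
  \<comment> \<open>Twice the constant of the centred part plus twice that of the mean part, from
    the inequality for the squared norm of a sum.\<close>
  let ?C = "2 * V + 2 * (K\<^sup>2 * t)"
  have C: "?C \<ge> 0" using V t by simp
  show ?thesis
  proof (intro exI[of _ ?C] allI impI)
    fix n \<tau> and D :: "nat \<Rightarrow> 'b \<Rightarrow>\<^sub>L 'b" assume p: "partition_upto t n \<tau>"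
    let ?S = "\<Sum>j<n. (norm (D j))\<^sup>2 * (\<tau> (Suc j) - \<tau> j)"
    let ?N = "step_integral compensated n \<tau> D" and ?m = "step_integral (\<lambda>t \<omega>. mean_at t) n \<tau> D"
    have L: "step_integral L n \<tau> D = (\<lambda>\<omega>. ?N \<omega> + ?m \<omega>)"
      unfolding step_integral_add[symmetric] by (simp add: compensated_def)
    note N = step_integral_compensated[OF p, of D]
    have \<Delta>: "\<tau> (Suc j) - \<tau> j \<ge> 0" if "j < n" for j using p that by (simp add: partition_upto_def)
    hence S: "?S \<ge> 0" by (intro sum_nonneg mult_nonneg_nonneg) auto
    have "(\<Sum>j<n. (norm (D j))\<^sup>2 * var_at (\<tau> (Suc j) - \<tau> j)) \<le> (\<Sum>j<n. (norm (D j))\<^sup>2 * (V * (\<tau> (Suc j) - \<tau> j)))"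
      using \<Delta> by (intro sum_mono mult_left_mono V) auto
    also have "\<dots> = V * ?S" by (simp add: sum_distrib_left mult_ac)
    finally have NV: "expectation (\<lambda>\<omega>. (norm (?N \<omega>))\<^sup>2) \<le> V * ?S" using N(3) by linarith
    have "expectation (\<lambda>\<omega>. (norm (step_integral L n \<tau> D \<omega>))\<^sup>2)
        \<le> expectation (\<lambda>\<omega>. 2 * (norm (?N \<omega>))\<^sup>2 + 2 * (K\<^sup>2 * t * ?S))"
    proof (rule integral_mono)
      show "integrable M (\<lambda>\<omega>. (norm (step_integral L n \<tau> D \<omega>))\<^sup>2)"
        using step_integral_in_L2[OF p] by (simp add: in_L2_def)
      show "integrable M (\<lambda>\<omega>. 2 * (norm (?N \<omega>))\<^sup>2 + 2 * (K\<^sup>2 * t * ?S))"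
        using N(2) by (simp add: in_L2_def)
      fix \<omega>
      show "(norm (step_integral L n \<tau> D \<omega>))\<^sup>2 \<le> 2 * (norm (?N \<omega>))\<^sup>2 + 2 * (K\<^sup>2 * t * ?S)"
        using power2_norm_add_le[of "?N \<omega>" "?m \<omega>"] step_integral_mean_bound[OF p K, of D \<omega>]
        unfolding L by linarith
    qed
    also have "\<dots> = 2 * expectation (\<lambda>\<omega>. (norm (?N \<omega>))\<^sup>2) + 2 * (K\<^sup>2 * t * ?S)"
      using N(2) by (simp add: in_L2_def prob_space)
    also have "\<dots> \<le> ?C * ?S" using NV by (simp add: distrib_right)
    finally have E: "expectation (\<lambda>\<omega>. (norm (step_integral L n \<tau> D \<omega>))\<^sup>2) \<le> ?C * ?S" .
    have "(\<integral>\<^sup>+\<omega>. ennreal ((norm (step_integral L n \<tau> D \<omega>))\<^sup>2) \<partial>M)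
        = ennreal (expectation (\<lambda>\<omega>. (norm (step_integral L n \<tau> D \<omega>))\<^sup>2))"
      using step_integral_in_L2[OF p] by (intro nn_integral_eq_integral) (auto simp: in_L2_def)
    also have "\<dots> \<le> ennreal ?C * ennreal ?S"
      using E S C by (simp add: ennreal_mult[symmetric] ennreal_leI)
    also have "\<dots> \<le> ennreal ?C * (\<integral>\<^sup>+s\<in>{0..t}. ennreal ((norm (step_integrand n \<tau> D s))\<^sup>2) \<partial>lborel)"
      by (intro mult_left_mono sum_partition_le_nn_integral[OF p]) simp
    finally show "(\<integral>\<^sup>+\<omega>. ennreal ((norm (step_integral L n \<tau> D \<omega>))\<^sup>2) \<partial>M)
      \<le> ennreal ?C * (\<integral>\<^sup>+s\<in>{0..t}. ennreal ((norm (step_integrand n \<tau> D s))\<^sup>2) \<partial>lborel)" .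
  qed
qed

section \<open>Operators that annihilate the stochastic integral\<close>

text \<open>Only the limit satisfies the algebraic relation with \<open>P\<close> and
  \<open>Q\<close>, while the approximating step functions need not. Compressing them to
  \<open>P\<close> A \<open>Q\<close> removes the limit and leaves an error to which the mean-square
  estimate applies.\<close>

lemma levy_integral_in_kernel:
  fixes P Q :: "'b \<Rightarrow>\<^sub>L 'b"
  assumes t: "t \<ge> 0" and P: "norm P \<le> 1" and Q: "norm Q \<le> 1"
    and QL: "\<And>s. s \<ge> 0 \<Longrightarrow> AE \<omega> in M. Q (L s \<omega>) = L s \<omega>"
    and P\<Phi>Q: "\<And>s. P o\<^sub>L \<Phi> s o\<^sub>L Q = 0"
    and X: "has_levy_integral M L t \<Phi> X"
  shows "AE \<omega> in M. P (X \<omega>) = 0"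
proof -
  have Xm: "X \<in> borel_measurable M" using X by (simp add: has_levy_integral_def)
  obtain n \<tau> A where p: "\<And>k. partition_upto t (n k) (\<tau> k)"
    and A: "(\<lambda>k. \<integral>\<^sup>+s\<in>{0..t}. ennreal ((norm (step_integrand (n k) (\<tau> k) (A k) s - \<Phi> s))\<^sup>2) \<partial>lborel) \<longlonglongrightarrow> 0"
    and I: "(\<lambda>k. \<integral>\<^sup>+\<omega>. ennreal ((norm (step_integral L (n k) (\<tau> k) (A k) \<omega> - X \<omega>))\<^sup>2) \<partial>M) \<longlonglongrightarrow> 0"
    using X unfolding has_levy_integral_def by blast
  obtain K where K: "\<And>n \<tau> D. partition_upto t n \<tau> \<Longrightarrow>
    (\<integral>\<^sup>+\<omega>. ennreal ((norm (step_integral L n \<tau> D \<omega>))\<^sup>2) \<partial>M)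
      \<le> ennreal K * (\<integral>\<^sup>+s\<in>{0..t}. ennreal ((norm (step_integrand n \<tau> D s))\<^sup>2) \<partial>lborel)"
    using step_integral_bound[OF t] by blast
  define D where "D k j = P o\<^sub>L A k j o\<^sub>L Q" for k j
  let ?a = "\<lambda>k. \<integral>\<^sup>+s\<in>{0..t}. ennreal ((norm (step_integrand (n k) (\<tau> k) (A k) s - \<Phi> s))\<^sup>2) \<partial>lborel"
  let ?i = "\<lambda>k. \<integral>\<^sup>+\<omega>. ennreal ((norm (step_integral L (n k) (\<tau> k) (A k) \<omega> - X \<omega>))\<^sup>2) \<partial>M"
  have norm_D: "norm (step_integrand (n k) (\<tau> k) (D k) s) \<le> norm (step_integrand (n k) (\<tau> k) (A k) s - \<Phi> s)" for k s
  proof -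
    let ?B = "step_integrand (n k) (\<tau> k) (A k) s - \<Phi> s"
    have "step_integrand (n k) (\<tau> k) (D k) s = P o\<^sub>L step_integrand (n k) (\<tau> k) (A k) s o\<^sub>L Q"
      by (rule blinfun_eqI) (simp add: step_integrand_def D_def blinfun.sum_left blinfun.sum_right blinfun.scaleR_left blinfun.scaleR_right)
    \<comment> \<open>Subtracting \<Phi> changes nothing between \<open>P\<close> and
      \<open>Q\<close>, and turns the compressed step function into a compressed approximation
      error.\<close>
    also have "\<dots> = P o\<^sub>L ?B o\<^sub>L Q"
    proof (rule blinfun_eqI)
      fix x
      have "(P o\<^sub>L \<Phi> s o\<^sub>L Q) x = 0" by (simp only: P\<Phi>Q blinfun.zero_left)
      thus "(P o\<^sub>L step_integrand (n k) (\<tau> k) (A k) s o\<^sub>L Q) x = (P o\<^sub>L ?B o\<^sub>L Q) x"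
        by (simp add: blinfun.diff_left blinfun.diff_right)
    qed
    finally have "norm (step_integrand (n k) (\<tau> k) (D k) s) \<le> norm (P o\<^sub>L ?B) * norm Q"
      by (simp add: norm_blinfun_compose)
    also have "\<dots> \<le> norm (P o\<^sub>L ?B) * 1" by (intro mult_left_mono Q) simp
    also have "norm (P o\<^sub>L ?B) \<le> norm P * norm ?B" by (rule norm_blinfun_compose)
    also have "\<dots> \<le> 1 * norm ?B" by (intro mult_right_mono P) simp
    finally show ?thesis by simp
  qed
  have b: "(\<integral>\<^sup>+\<omega>. ennreal ((norm (P (X \<omega>)))\<^sup>2) \<partial>M) \<le> 2 * ?i k + 2 * (ennreal K * ?a k)" for k
  proof -
    let ?I = "step_integral L (n k) (\<tau> k) (A k)" and ?J = "step_integral L (n k) (\<tau> k) (D k)"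
    have [measurable]: "?I \<in> borel_measurable M" "?J \<in> borel_measurable M" "X \<in> borel_measurable M"
      using step_integral_in_L2[OF p] Xm by (auto simp: in_L2_def)
    \<comment> \<open>Only finitely many times matter for a given \<open>k\<close>, so one null set
      suffices. The index \<open>n k\<close> is included because the increments use both end
      points.\<close>
    have "AE \<omega> in M. \<forall>j\<in>{..n k}. Q (L (\<tau> k j) \<omega>) = L (\<tau> k j) \<omega>"
    proof (rule AE_finite_allI)
      fix j assume "j \<in> {..n k}"
      hence "\<tau> k j \<ge> 0"
        using partition_upto_mono[OF p[of k], of 0 j] p[of k] by (simp add: partition_upto_def)
      thus "AE \<omega> in M. Q (L (\<tau> k j) \<omega>) = L (\<tau> k j) \<omega>" by (rule QL)
    qed simp
    hence "AE \<omega> in M. norm (P (X \<omega>)) \<le> norm (?I \<omega> - X \<omega>) + norm (?J \<omega>)"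
    proof eventually_elim
      case (elim \<omega>)
      have "P (?I \<omega>) = ?J \<omega>"
        unfolding step_integral_def blinfun.sum_right
        using elim by (intro sum.cong refl) (simp add: D_def blinfun.diff_right)
      \<comment> \<open>One error comes from approximating the integral, the other is the integral
        of the compressed step function; both vanish in mean square.\<close>
      hence "P (X \<omega>) = ?J \<omega> - P (?I \<omega> - X \<omega>)" by (simp add: blinfun.diff_right)
      hence "norm (P (X \<omega>)) \<le> norm (?J \<omega>) + norm (P (?I \<omega> - X \<omega>))"
        using norm_triangle_ineq4 by metis
      moreover have "norm (P (?I \<omega> - X \<omega>)) \<le> 1 * norm (?I \<omega> - X \<omega>)"
        by (rule order_trans[OF norm_blinfun]) (intro mult_right_mono P norm_ge_zero)
      ultimately show ?case by simp
    qed
    hence "(\<integral>\<^sup>+\<omega>. ennreal ((norm (P (X \<omega>)))\<^sup>2) \<partial>M)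
        \<le> (\<integral>\<^sup>+\<omega>. ennreal ((norm (norm (?I \<omega> - X \<omega>) + norm (?J \<omega>)))\<^sup>2) \<partial>M)"
      by (intro nn_integral_mono_AE) (auto intro!: ennreal_leI power_mono elim!: AE_mp)
    also have "\<dots> \<le> 2 * (\<integral>\<^sup>+\<omega>. ennreal ((norm (norm (?I \<omega> - X \<omega>)))\<^sup>2) \<partial>M)
        + 2 * (\<integral>\<^sup>+\<omega>. ennreal ((norm (norm (?J \<omega>)))\<^sup>2) \<partial>M)"
      by (rule nn_integral_power2_norm_add_le) measurable
    also have "\<dots> = 2 * ?i k + 2 * (\<integral>\<^sup>+\<omega>. ennreal ((norm (?J \<omega>))\<^sup>2) \<partial>M)" by simp
    also have "(\<integral>\<^sup>+\<omega>. ennreal ((norm (?J \<omega>))\<^sup>2) \<partial>M)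
        \<le> ennreal K * (\<integral>\<^sup>+s\<in>{0..t}. ennreal ((norm (step_integrand (n k) (\<tau> k) (D k) s))\<^sup>2) \<partial>lborel)"
      by (rule K[OF p])
    also have "\<dots> \<le> ennreal K * ?a k"
      by (intro mult_left_mono nn_integral_mono mult_right_mono ennreal_leI power_mono norm_D) auto
    finally show ?thesis by (simp add: add_left_mono mult_left_mono)
  qed
  \<comment> \<open>The quantity bounded in \<open>b\<close> does not depend on \<open>k\<close>, so
    it is at most the limit of the bounds, which is 0.\<close>
  have "(\<lambda>k. 2 * ?i k + 2 * (ennreal K * ?a k)) \<longlonglongrightarrow> 2 * 0 + 2 * (ennreal K * 0)"
    by (intro tendsto_add ennreal_tendsto_cmult A I) auto
  hence "(\<integral>\<^sup>+\<omega>. ennreal ((norm (P (X \<omega>)))\<^sup>2) \<partial>M) \<le> 0"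
    using b by (intro LIMSEQ_le_const[of "\<lambda>k. 2 * ?i k + 2 * (ennreal K * ?a k)"]) auto
  moreover have "(\<lambda>\<omega>. P (X \<omega>)) \<in> borel_measurable M"
    by (rule borel_measurable_continuous_on[OF _ Xm]) (intro continuous_intros)
  ultimately have "AE \<omega> in M. ennreal ((norm (P (X \<omega>)))\<^sup>2) = 0"
    by (subst nn_integral_0_iff_AE[symmetric]) auto
  thus ?thesis by (simp add: ennreal_eq_0_iff)
qed

end

section \<open>Commutation with the exponential\<close>

text \<open>The powers of \<open>A\<close> commute with \<open>B\<close> by induction, and
  composition with \<open>B\<close> on either side is bounded linear, so it passes through the
  exponential series.\<close>

lemma blinfun_exp_commute:
  fixes A B :: "'b::banach \<Rightarrow>\<^sub>L 'b"
  assumes AB: "A o\<^sub>L B = B o\<^sub>L A"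
  shows "blinfun_exp A o\<^sub>L B = B o\<^sub>L blinfun_exp A"
proof -
  let ?e = "\<lambda>n. (1 / fact n) *\<^sub>R (blinfun_compose A ^^ n) id_blinfun"
  have AB': "A (B x) = B (A x)" for x
    using arg_cong[OF AB, of "\<lambda>f. blinfun_apply f x"] by simp
  have pow: "(blinfun_compose A ^^ n) id_blinfun o\<^sub>L B = B o\<^sub>L (blinfun_compose A ^^ n) id_blinfun" for n
  proof (induction n)
    case (Suc n)
    show ?case
    proof (rule blinfun_eqI)
      fix x
      show "((blinfun_compose A ^^ Suc n) id_blinfun o\<^sub>L B) x = (B o\<^sub>L (blinfun_compose A ^^ Suc n) id_blinfun) x"
        using arg_cong[OF Suc, of "\<lambda>f. blinfun_apply f x"] by (simp add: AB')
    qed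
  qed (auto intro: blinfun_eqI)
  have "blinfun_exp A o\<^sub>L B = (\<Sum>n. ?e n o\<^sub>L B)"
    unfolding blinfun_exp_def
    by (rule bounded_linear.suminf[OF bounded_bilinear.bounded_linear_left[OF bounded_bilinear_blinfun_compose] summable_blinfun_exp])
  also have "\<dots> = (\<Sum>n. B o\<^sub>L ?e n)"
    using pow by (simp add: bounded_bilinear.scaleR_left[OF bounded_bilinear_blinfun_compose]
        bounded_bilinear.scaleR_right[OF bounded_bilinear_blinfun_compose])
  also have "\<dots> = B o\<^sub>L blinfun_exp A"
    unfolding blinfun_exp_def
    by (rule bounded_linear.suminf[OF bounded_bilinear.bounded_linear_right[OF bounded_bilinear_blinfun_compose] summable_blinfun_exp, symmetric])
  finally show ?thesis .
qed

section \<open>The adjoint map as an isometric involution\<close>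

lemma inner_hs_adjoint: "inner (op_of (hs_adjoint T) x) y = inner x (op_of T y)"
  using inner_adjoint[OF blinfun.bounded_linear_right, of "op_of T" y x]
  by (simp add: hs_adjoint_apply inner_commute)

text \<open>Reduces algebraic identities for \<open>hs_adjoint\<close> to the defining relation of
  the adjoint.\<close>

lemma hs_eqI:
  assumes "\<And>x y. inner (op_of S x) y = inner (op_of T x) y" shows "S = T"
  using assms by (intro op_of_inject[THEN iffD1] blinfun_eqI) (metis vector_eq_rdot)

lemma hs_adjoint_hs_adjoint: "hs_adjoint (hs_adjoint T) = T"
  by (rule hs_eqI) (metis inner_hs_adjoint inner_commute)

text \<open>Both squared norms are the sum of all squared matrix entries in an orthonormal basis,
  which is invariant under transposition.\<close>

lemma norm_hs_adjoint: "norm (hs_adjoint T) = norm T"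
proof -
  have "((\<lambda>e. (norm (op_of (hs_adjoint T) e))\<^sup>2) has_sum (norm T)\<^sup>2) hs_basis"
    unfolding hs_adjoint_apply
    by (rule has_sum_norm_adjoint[OF blinfun.bounded_linear_right hs_basis hs_basis norm_hs_has_sum[OF hs_basis]])
  hence "(norm (hs_adjoint T))\<^sup>2 = (norm T)\<^sup>2"
    using norm_hs_has_sum[OF hs_basis, of "hs_adjoint T"] has_sum_unique by blast
  thus ?thesis by simp
qed

lemma bounded_linear_hs_adjoint: "bounded_linear hs_adjoint"
proof (rule bounded_linear_intro[of _ 1])
  show "hs_adjoint (S + T) = hs_adjoint S + hs_adjoint T" for S T :: "'a hs"
    by (rule hs_eqI) (simp add: inner_hs_adjoint plus_hs.rep_eq blinfun.add_left inner_add_left inner_add_right)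
  show "hs_adjoint (r *\<^sub>R T) = r *\<^sub>R hs_adjoint T" for r and T :: "'a hs"
    by (rule hs_eqI) (simp add: inner_hs_adjoint scaleR_hs.rep_eq blinfun.scaleR_left)
qed (simp add: norm_hs_adjoint)

section \<open>Self-adjointness of the mild solution\<close>

theorem proposition2p6:
  fixes M :: "'w measure" and F :: "real \<Rightarrow> 'w measure"
    and C :: "'a::separable_hilbert hs \<Rightarrow>\<^sub>L 'a hs"
    and L Y :: "real \<Rightarrow> 'w \<Rightarrow> 'a hs" and Y0 :: "'a hs"
  assumes "square_integrable_levy_process M F L"
    and "\<forall>T. hs_adjoint (blinfun_apply C T) = blinfun_apply C (hs_adjoint T)"
    and "\<forall>t\<ge>0. AE \<omega> in M. self_adjoint (L t \<omega>)"
    and "self_adjoint Y0"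
    and "mild_solution M L C Y0 Y"
  shows "\<forall>t\<ge>0. AE \<omega> in M. self_adjoint (Y t \<omega>)"
proof (intro allI impI)
  fix t :: real assume t: "t \<ge> 0"
  interpret square_integrable_levy_process M F L by (rule assms(1))
  interpret hilbert_levy_process M F L ..
  define J :: "'a hs \<Rightarrow>\<^sub>L 'a hs" where "J = Blinfun hs_adjoint"
  have J: "J T = hs_adjoint T" for T
    by (simp add: J_def bounded_linear_Blinfun_apply bounded_linear_hs_adjoint)
  define P where "P = (1/2) *\<^sub>R (id_blinfun - J)"
  define Q where "Q = (1/2) *\<^sub>R (id_blinfun + J)"
  let ?S = "\<lambda>s. blinfun_exp (s *\<^sub>R C)"
  have PT: "P T = (1/2) *\<^sub>R (T - hs_adjoint T)" for T
    by (simp add: P_def J blinfun.scaleR_left blinfun.diff_left)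
  have QT: "Q T = (1/2) *\<^sub>R (T + hs_adjoint T)" for T
    by (simp add: Q_def J blinfun.scaleR_left blinfun.add_left)
  have P1: "norm P \<le> 1"
  proof (rule norm_blinfun_bound)
    show "norm (P T) \<le> 1 * norm T" for T
      using norm_triangle_ineq4[of T "hs_adjoint T"] by (simp add: PT norm_hs_adjoint)
  qed simp
  have Q1: "norm Q \<le> 1"
  proof (rule norm_blinfun_bound)
    show "norm (Q T) \<le> 1 * norm T" for T
      using norm_triangle_ineq[of T "hs_adjoint T"] by (simp add: QT norm_hs_adjoint)
  qed simp
  \<comment> \<open>The assumption on \<open>C\<close> says that \<open>C\<close> commutes with
    \<open>J\<close>; multiples of \<open>C\<close> then do as well, and so do their
    exponentials.\<close>
  have "?S s o\<^sub>L J = J o\<^sub>L ?S s" for s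
    using assms(2) by (intro blinfun_exp_commute blinfun_eqI) (simp add: J blinfun.scaleR_left blinfun.scaleR_right flip: J)
  hence comm: "hs_adjoint (?S s T) = ?S s (hs_adjoint T)" for s T
    by (metis J blinfun_apply_blinfun_compose)
  \<comment> \<open>\<open>Q\<close> maps into the self-adjoint operators, the semigroup preserves
    them, and \<open>P\<close> vanishes on them.\<close>
  have PSQ: "P o\<^sub>L ?S s o\<^sub>L Q = 0" for s
  proof (rule blinfun_eqI)
    fix T
    have "hs_adjoint (Q T) = Q T"
      unfolding QT by (simp add: linear_simps[OF bounded_linear_hs_adjoint] hs_adjoint_hs_adjoint add.commute)
    thus "(P o\<^sub>L ?S s o\<^sub>L Q) T = blinfun_apply 0 T" by (simp add: PT comm)
  qed
  have QL: "AE \<omega> in M. Q (L s \<omega>) = L s \<omega>" if "s \<ge> 0" for s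
  proof -
    have "AE \<omega> in M. self_adjoint (L s \<omega>)" using assms(3) that by blast
    thus ?thesis
      by eventually_elim (simp add: self_adjoint_def QT scaleR_half_double)
  qed
  obtain I where I: "has_levy_integral M L t (\<lambda>s. ?S (t - s)) I"
    and Y: "AE \<omega> in M. Y t \<omega> = ?S t Y0 + I \<omega>"
    using assms(5) t unfolding mild_solution_def by blast
  \<comment> \<open>\<open>PSQ\<close> holds for every real time, in particular at
    \<open>t - s\<close>, where the convolution evaluates the semigroup.\<close>
  have "AE \<omega> in M. P (I \<omega>) = 0"
    by (rule levy_integral_in_kernel[OF t P1 Q1 QL PSQ I])
  with Y show "AE \<omega> in M. self_adjoint (Y t \<omega>)"
  proof eventually_elim
    case (elim \<omega>)
    hence "hs_adjoint (I \<omega>) = I \<omega>" by (simp add: PT)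
    \<comment> \<open>The term with \<open>Y0\<close> is self-adjoint by \<open>comm\<close>, and
      the sum is handled by additivity of \<open>hs_adjoint\<close>.\<close>
    thus ?case
      using elim assms(4) by (simp add: self_adjoint_def linear_simps[OF bounded_linear_hs_adjoint] comm)
  qed
qed

end
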